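(* Let $\Delta$ be a simplicial complex on $[n]$ and $\mathscr G$ a full arrangement of subcomplexes of $\Delta$. Let $M=M[\Delta,\bigcup\mathscr G]$ and $N=N[\Delta,\mathscr G]$. Then $M\cong N/(I_\Delta\cap N)$, and for every collection of linear forms $\Theta$, $\dim_k(M/\Theta M)_k\le\dim_k(N/\Theta N)_k$ for all $k$. If $\Theta$ is a linear system of parameters for $M$ and the surjection $N\to M$ is a $\Theta$-surjection, then the following are equivalent: (i) equality holds for some $k_0$; (ii) $M_k\cong N_k$ for all $k\le k_0$; (iii) $I_\Delta\cap N$ is generated in degrees $>k_0$; (iv) every non-face of $\Delta$ of dimension $<k_0$ has its vertex set contained in $V(\Gamma)$ for some $\Gamma\in\mathscr G$.
   Context: $k$ an infinite field, $k[\mathbf x]=k[x_1,\dots,x_n]$, $I_\Delta=\langle\mathbf x^\tau:\tau\notin\Delta\rangle$. A subcomplex $\Gamma\subseteq\Delta$ is full if every face of $\Delta$ with all vertices in $\Gamma$ lies in $\Gamma$; a full arrangement is a finite collection $\mathscr G$ of full subcomplexes, and $\bigcup\mathscr G$ is their union. $V(\Gamma)$ is the vertex set of $\Gamma$. The face module of $(\Delta,\Gamma)$ is $M[\Delta,\Gamma]=I_\Gamma/I_\Delta$. The nerve ideal is $N[\Delta,\mathscr G]=\langle\mathbf x^\tau:\tau\not\subseteq V(\Gamma)\text{ for all }\Gamma\in\mathscr G\rangle$. For modules and a sequence $\Theta=(\theta_1,\dots,\theta_\ell)$, write $\Theta_s=(\theta_1,\dots,\theta_s)$; a surjection $\varphi:B\to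 A$ is a $\Theta$-surjection if for every $1\le s\le\ell$ it induces a surjection $(\Theta_{s-1}B:\theta_s)/\Theta_{s-1}B\to(\Theta_{s-1}A:\theta_s)/\Theta_{s-1}A$. A linear system of parameters for $M$ is a sequence of $\dim M$ linear forms with $\dim M/\Theta M=0$. *)

theory Defs
  imports
    "HOL-Library.Poly_Mapping"
    "HOL-Library.Extended_Real"
    "HOL-Algebra.QuotRing"
    "Jordan_Normal_Form.VS_Connect"
begin

section \<open>The polynomial ring\<close>

text \<open>A monomial is a finitely supported exponent function, a polynomial a finitely supported
  coefficient function on monomials.  The type has variables indexed by all natural numbers;
  the polynomial ring in the variables with indices in \<open>{1..n}\<close> is cut out by its carrier.\<close>

type_synonym 'k mpoly = "(nat \<Rightarrow>\<^sub>0 nat) \<Rightarrow>\<^sub>0 'k"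

definition poly_ring :: "nat \<Rightarrow> 'k::field mpoly ring" where
  "poly_ring n =
    \<lparr>carrier = {p. \<forall>m\<in>Poly_Mapping.keys p. Poly_Mapping.keys m \<subseteq> {1..n}},
     mult = (*), one = 1, zero = 0, add = (+)\<rparr>"

definition mdegree :: "(nat \<Rightarrow>\<^sub>0 nat) \<Rightarrow> nat" where
  "mdegree m = (\<Sum>i\<in>Poly_Mapping.keys m. Poly_Mapping.lookup m i)"

definition homogeneous :: "nat \<Rightarrow> nat \<Rightarrow> 'k::field mpoly set" where
  "homogeneous n d = {p \<in> carrier (poly_ring n). \<forall>m\<in>Poly_Mapping.keys p. mdegree m = d}"

definition sqfree_monomial :: "nat set \<Rightarrow> 'k::field mpoly" where
  "sqfree_monomial \<tau> = Poly_Mapping.single (\<Sum>i\<in>\<tau>. Poly_Mapping.single i 1) 1"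

section \<open>Graded modules\<close>

text \<open>The fields \<open>mult\<close> and \<open>one\<close> that \<open>module\<close> inherits from \<open>ring\<close> play no role for modules.\<close>

record ('a, 'b) graded_module = "('a, 'b) module" +
  piece :: "nat \<Rightarrow> 'b set"

definition ideal_module :: "nat \<Rightarrow> 'k::field mpoly set \<Rightarrow> ('k mpoly, 'k mpoly) graded_module" where
  "ideal_module n I =
    \<lparr>carrier = I, mult = (*), one = 1, zero = 0, add = (+), smult = (*),
     piece = (\<lambda>d. I \<inter> homogeneous n d)\<rparr>"

definition quotient_module ::
  "('a, 'b, 'c) graded_module_scheme \<Rightarrow> 'b set \<Rightarrow> ('a, 'b set) graded_module" where
  "quotient_module A K =
    \<lparr>carrier = a_rcosets\<^bsub>A\<^esub> K, mult = undefined, one = undefined,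
     zero = K, add = set_add A,
     smult = (\<lambda>r X. \<Union>x\<in>X. K +>\<^bsub>A\<^esub> (r \<odot>\<^bsub>A\<^esub> x)),
     piece = (\<lambda>d. (\<lambda>x. K +>\<^bsub>A\<^esub> x) ` piece A d)\<rparr>"

definition module_iso ::
  "('a, 'r) ring_scheme \<Rightarrow> ('a, 'b, 'c) module_scheme \<Rightarrow> ('a, 'd, 'e) module_scheme
    \<Rightarrow> ('b \<Rightarrow> 'd) set" where
  "module_iso R A B = {f \<in> module_hom R A B. bij_betw f (carrier A) (carrier B)}"

definition graded_isomorphic ::
  "('a, 'r) ring_scheme \<Rightarrow> ('a, 'b, 'c) graded_module_scheme
    \<Rightarrow> ('a, 'd, 'e) graded_module_scheme \<Rightarrow> bool" where
  "graded_isomorphic R A B \<longleftrightarrow>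
    (\<exists>f\<in>module_iso R A B. \<forall>d. f ` piece A d = piece B d)"

text \<open>The degree-\<open>d\<close> piece as a vector space over the coefficient field, which acts through the
  constant polynomials.\<close>

definition piece_space ::
  "('k::field mpoly, 'b, 'c) graded_module_scheme \<Rightarrow> nat \<Rightarrow> ('k, 'b) module" where
  "piece_space A d =
    \<lparr>carrier = piece A d, mult = mult A, one = one A, zero = zero A, add = add A,
     smult = (\<lambda>c x. Poly_Mapping.single 0 c \<odot>\<^bsub>A\<^esub> x)\<rparr>"

definition piece_dim :: "('k::field mpoly, 'b, 'c) graded_module_scheme \<Rightarrow> nat \<Rightarrow> nat" where
  "piece_dim A d = vectorspace.dim class_ring (piece_space A d)"

definition pieces_isomorphic ::
  "('k::field mpoly, 'b, 'c) graded_module_scheme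
    \<Rightarrow> ('k mpoly, 'd, 'e) graded_module_scheme \<Rightarrow> nat \<Rightarrow> bool" where
  "pieces_isomorphic A B d \<longleftrightarrow> module_iso class_ring (piece_space A d) (piece_space B d) \<noteq> {}"

section \<open>Krull dimension and linear systems of parameters\<close>

text \<open>The supremum is taken in the extended reals so that the zero ring, which has no prime
  ideals, gets dimension \<open>-\<infinity>\<close>.\<close>

definition krull_dim :: "('a, 'r) ring_scheme \<Rightarrow> ereal" where
  "krull_dim R =
    Sup {ereal (real k) | k. \<exists>P :: nat \<Rightarrow> 'a set.
      (\<forall>i\<le>k. primeideal (P i) R) \<and> (\<forall>i<k. P i \<subset> P (Suc i))}"

definition annihilator ::
  "('a, 'r) ring_scheme \<Rightarrow> ('a, 'b, 'c) module_scheme \<Rightarrow> 'a set" where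
  "annihilator R A = {r \<in> carrier R. \<forall>x\<in>carrier A. r \<odot>\<^bsub>A\<^esub> x = \<zero>\<^bsub>A\<^esub>}"

definition module_dim ::
  "('a, 'r) ring_scheme \<Rightarrow> ('a, 'b, 'c) module_scheme \<Rightarrow> ereal" where
  "module_dim R A = krull_dim (R Quot annihilator R A)"

text \<open>The submodule \<open>\<Theta>A\<close>.\<close>

definition seq_mult ::
  "('a, 'r) ring_scheme \<Rightarrow> 'a list \<Rightarrow> ('a, 'b, 'c) module_scheme \<Rightarrow> 'b set" where
  "seq_mult R \<Theta> A = module.span R A {\<theta> \<odot>\<^bsub>A\<^esub> x | \<theta> x. \<theta> \<in> set \<Theta> \<and> x \<in> carrier A}"

definition lsop ::
  "nat \<Rightarrow> ('k::field mpoly, 'b, 'c) graded_module_scheme \<Rightarrow> 'k mpoly list \<Rightarrow> bool" where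
  "lsop n A \<Theta> \<longleftrightarrow>
    set \<Theta> \<subseteq> homogeneous n 1 \<and>
    ereal (real (length \<Theta>)) = module_dim (poly_ring n) A \<and>
    module_dim (poly_ring n) (quotient_module A (seq_mult (poly_ring n) \<Theta> A)) = 0"

section \<open>Surjections compatible with a sequence\<close>

definition colon :: "('a, 'b, 'c) module_scheme \<Rightarrow> 'b set \<Rightarrow> 'a \<Rightarrow> 'b set" where
  "colon A S \<theta> = {x \<in> carrier A. \<theta> \<odot>\<^bsub>A\<^esub> x \<in> S}"

text \<open>The underlying set of \<open>(S : \<theta>)/S\<close>.\<close>

definition colon_quotient :: "('a, 'b, 'c) module_scheme \<Rightarrow> 'b set \<Rightarrow> 'a \<Rightarrow> 'b set set" where
  "colon_quotient A S \<theta> = (\<lambda>x. S +>\<^bsub>A\<^esub> x) ` colon A S \<theta>"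

text \<open>Lists are indexed from \<open>0\<close>, so \<open>take s \<Theta>\<close> and \<open>\<Theta> ! s\<close> are
  \<open>\<Theta>\<^sub>s = (\<theta>\<^sub>1, \<dots>, \<theta>\<^sub>s)\<close> and \<open>\<theta>\<close> with index \<open>s + 1\<close>.
  The map \<open>X \<mapsto> \<Union>x\<in>X. T + \<phi> x\<close> sends the class of \<open>x\<close> to the class of \<open>\<phi> x\<close>.\<close>

definition seq_surjection ::
  "('a, 'r) ring_scheme \<Rightarrow> 'a list \<Rightarrow> ('a, 'b, 'c) module_scheme \<Rightarrow> ('a, 'd, 'e) module_scheme
    \<Rightarrow> ('b \<Rightarrow> 'd) \<Rightarrow> bool" where
  "seq_surjection R \<Theta> B A \<phi> \<longleftrightarrow>
    \<phi> \<in> module_hom R B A \<and> \<phi> ` carrier B = carrier A \<and>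
    (\<forall>s<length \<Theta>.
      let S = seq_mult R (take s \<Theta>) B; T = seq_mult R (take s \<Theta>) A; \<theta> = \<Theta> ! s
      in (\<lambda>X. \<Union>x\<in>X. T +>\<^bsub>A\<^esub> \<phi> x) ` colon_quotient B S \<theta> = colon_quotient A T \<theta>)"

section \<open>Simplicial complexes, face modules and nerve ideals\<close>

text \<open>Neither is every element of \<open>{1..n}\<close> required to be a vertex, nor is the void
  complex \<open>{}\<close> excluded.\<close>

definition simplicial_complex :: "nat \<Rightarrow> nat set set \<Rightarrow> bool" where
  "simplicial_complex n \<Delta> \<longleftrightarrow> \<Delta> \<subseteq> Pow {1..n} \<and> (\<forall>\<sigma>\<in>\<Delta>. \<forall>\<tau>\<subseteq>\<sigma>. \<tau> \<in> \<Delta>)"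

definition vertex_set :: "nat set set \<Rightarrow> nat set" where
  "vertex_set \<Gamma> = {v. {v} \<in> \<Gamma>}"

definition full_subcomplex :: "nat \<Rightarrow> nat set set \<Rightarrow> nat set set \<Rightarrow> bool" where
  "full_subcomplex n \<Delta> \<Gamma> \<longleftrightarrow>
    simplicial_complex n \<Gamma> \<and> \<Gamma> \<subseteq> \<Delta> \<and> (\<forall>\<sigma>\<in>\<Delta>. \<sigma> \<subseteq> vertex_set \<Gamma> \<longrightarrow> \<sigma> \<in> \<Gamma>)"

definition full_arrangement :: "nat \<Rightarrow> nat set set \<Rightarrow> nat set set set \<Rightarrow> bool" where
  "full_arrangement n \<Delta> \<G> \<longleftrightarrow> finite \<G> \<and> (\<forall>\<Gamma>\<in>\<G>. full_subcomplex n \<Delta> \<Gamma>)"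

definition stanley_reisner_ideal :: "nat \<Rightarrow> nat set set \<Rightarrow> 'k::field mpoly set" where
  "stanley_reisner_ideal n \<Delta> =
    genideal (poly_ring n) (sqfree_monomial ` {\<tau>. \<tau> \<subseteq> {1..n} \<and> \<tau> \<notin> \<Delta>})"

definition nerve_ideal :: "nat \<Rightarrow> nat set set set \<Rightarrow> 'k::field mpoly set" where
  "nerve_ideal n \<G> =
    genideal (poly_ring n)
      (sqfree_monomial ` {\<tau>. \<tau> \<subseteq> {1..n} \<and> (\<forall>\<Gamma>\<in>\<G>. \<not> \<tau> \<subseteq> vertex_set \<Gamma>)})"

definition face_module ::
  "nat \<Rightarrow> nat set set \<Rightarrow> nat set set \<Rightarrow> ('k::field mpoly, 'k mpoly set) graded_module" where
  "face_module n \<Delta> \<Gamma> =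
    quotient_module (ideal_module n (stanley_reisner_ideal n \<Gamma>)) (stanley_reisner_ideal n \<Delta>)"

definition generated_in_degrees_above :: "nat \<Rightarrow> nat \<Rightarrow> 'k::field mpoly set \<Rightarrow> bool" where
  "generated_in_degrees_above n k I \<longleftrightarrow>
    (\<exists>S \<subseteq> (\<Union>d\<in>{k<..}. homogeneous n d). I = genideal (poly_ring n) S)"

end

theory Submission
  imports Defs
begin

text \<open>
  Write \<open>K = I\<^sub>\<Delta> \<inter> N\<close>.  All ideals involved are squarefree monomial ideals, fullness gives
  \<open>I\<close> of the union of the arrangement as \<open>N + I\<^sub>\<Delta>\<close>, and hence \<open>M \<cong> N/K\<close>; the inequality follows because
  \<open>M/\<Theta>M\<close> is a quotient of \<open>N/\<Theta>N\<close>.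

  Each of the four conditions says that every generator of \<open>K\<close> has degree greater than \<open>k\<^sub>0\<close>.  The
  only hard implication starts from (i).  For a \<open>\<Theta>\<close>-surjection, \<open>K \<inter> \<Theta>N = \<Theta>K\<close>, so equality
  in degree \<open>k\<^sub>0\<close> means that the part of \<open>K\<close> in degree \<open>k\<^sub>0\<close> lies in \<open>\<Theta>K\<close>.
  If \<open>K \<noteq> 0\<close>, then the annihilator of \<open>M\<close> is nonzero, so \<open>\<Theta>\<close> has fewer than \<open>n\<close> members and its linear forms have a
  common zero \<open>p \<noteq> 0\<close>.  On the line \<open>(1, \<dots>, 1) + t p\<close> they are constant, which keeps
  the degree in \<open>t\<close> of \<open>x\<^sub>j\<^sup>m g\<close> below \<open>k\<^sub>0\<close> for all \<open>g \<in> K\<close> of degree \<open>k\<^sub>0\<close> and all \<open>m\<close>; if \<open>p\<^sub>j \<noteq> 0\<close>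
  and \<open>g\<close> is a monomial, this degree is at least \<open>m\<close>.  Hence \<open>K\<close> has no monomial of degree \<open>k\<^sub>0\<close>.
\<close>

section \<open>Squarefree monomial ideals\<close>

text \<open>Equality in the single degree \<open>k\<^sub>0\<close> has to exclude generators of K in
  all lower degrees too. A Nakayama argument sees only generators of degree \<open>k\<^sub>0\<close>
  itself: if \<Theta> consisted of all variables, any K generated below degree
  \<open>k\<^sub>0\<close> would have its part in degree \<open>k\<^sub>0\<close> inside \<Theta>K.
  So the length of \<Theta> must enter. Writing an element of degree \<open>k\<^sub>0\<close> in
  terms of \<Theta> leaves coefficients in K of degree one less; a factor \<open>x\<^sub>j\<close>
  lifts them back to degree \<open>k\<^sub>0\<close>, so the exchange can be repeated indefinitely
  although the hypothesis concerns one degree.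

  That a nonzero annihilator forces dimension below n is shown by counting. A chain of k strict
  inclusions of primes yields, for some fixed E and every m, binomially many (m + k over k)
  polynomials of degree at most E m that are independent modulo the bottom prime, whereas the whole
  ring has room for at most \<open>(E * m + 1) ^ n\<close>. A chain of nonzero primes can be
  extended downwards by the zero ideal, which gains the one inclusion needed for strictness.\<close>

lemma carrier_poly_ring: "carrier (poly_ring n) = {p. \<forall>m\<in>Poly_Mapping.keys p. Poly_Mapping.keys m \<subseteq> {1..n}}"
  and poly_ring_simps [simp]: "mult (poly_ring n) = (*)" "one (poly_ring n) = 1"
    "zero (poly_ring n) = 0" "add (poly_ring n) = (+)"
  by (simp_all add: poly_ring_def)

lemma keys_nat_add: "Poly_Mapping.keys (a + b) = Poly_Mapping.keys a \<union> Poly_Mapping.keys b"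
  for a b :: "nat \<Rightarrow>\<^sub>0 nat"
  by (auto simp: in_keys_iff lookup_add)

lemma mdegree_add: "mdegree (a + b) = mdegree a + mdegree b"
proof -
  have sum_superset: "mdegree m = (\<Sum>i\<in>Poly_Mapping.keys a \<union> Poly_Mapping.keys b. Poly_Mapping.lookup m i)"
    if "Poly_Mapping.keys m \<subseteq> Poly_Mapping.keys a \<union> Poly_Mapping.keys b" for m
    unfolding mdegree_def using that by (intro sum.mono_neutral_left) (auto simp: in_keys_iff)
  show ?thesis
    by (simp add: sum_superset keys_nat_add lookup_add sum.distrib)
qed

lemma mdegree_single [simp]: "mdegree (Poly_Mapping.single i c) = c"
  by (simp add: mdegree_def)

lemma mdegree_0 [simp]: "mdegree 0 = 0"
  by (simp add: mdegree_def)

text \<open>A squarefree monomial ideal is determined by the supports its monomials may have. In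
  this form sums and intersections of ideals become unions and intersections of sets, and membership
  is tested monomial by monomial.\<close>

definition supp_ideal :: "nat set set \<Rightarrow> 'k::field mpoly set" where
  "supp_ideal A = {p. \<forall>m\<in>Poly_Mapping.keys p. Poly_Mapping.keys m \<in> A}"

text \<open>These are exactly the complements in \<open>Pow {1..n}\<close> of simplicial
  complexes.\<close>

definition upclosed :: "nat \<Rightarrow> nat set set \<Rightarrow> bool" where
  "upclosed n A \<longleftrightarrow> A \<subseteq> Pow {1..n} \<and> (\<forall>\<sigma>\<in>A. \<forall>\<tau>. \<sigma> \<subseteq> \<tau> \<and> \<tau> \<subseteq> {1..n} \<longrightarrow> \<tau> \<in> A)"

lemma supp_ideal_0 [simp]: "0 \<in> supp_ideal A"
  by (simp add: supp_ideal_def)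

lemma supp_ideal_add: "p \<in> supp_ideal A \<Longrightarrow> q \<in> supp_ideal A \<Longrightarrow> p + q \<in> supp_ideal A"
  using keys_add[of p q] by (auto simp: supp_ideal_def)

lemma supp_ideal_uminus: "p \<in> supp_ideal A \<Longrightarrow> - p \<in> supp_ideal A"
  by (auto simp: supp_ideal_def in_keys_iff)

lemma supp_ideal_sum: "(\<And>x. x \<in> F \<Longrightarrow> f x \<in> supp_ideal A) \<Longrightarrow> sum f F \<in> supp_ideal A"
  by (induction F rule: infinite_finite_induct) (auto intro: supp_ideal_add)

lemma carrier_eq_supp_ideal: "carrier (poly_ring n) = supp_ideal (Pow {1..n})"
  by (simp add: carrier_poly_ring supp_ideal_def)

lemma supp_ideal_mono: "A \<subseteq> B \<Longrightarrow> supp_ideal A \<subseteq> supp_ideal B"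
  by (auto simp: supp_ideal_def)

lemma supp_ideal_Int: "supp_ideal A \<inter> supp_ideal B = supp_ideal (A \<inter> B)"
  by (auto simp: supp_ideal_def)

lemma upclosed_Pow [simp]: "upclosed n (Pow {1..n})"
  by (auto simp: upclosed_def)

lemma upclosed_Int: "upclosed n A \<Longrightarrow> upclosed n B \<Longrightarrow> upclosed n (A \<inter> B)"
  by (auto simp: upclosed_def)

lemma supp_ideal_subset_carrier: "upclosed n A \<Longrightarrow> supp_ideal A \<subseteq> carrier (poly_ring n)"
  by (auto simp: upclosed_def carrier_eq_supp_ideal intro!: supp_ideal_mono)

lemma supp_ideal_mult:
  assumes "upclosed n A" "p \<in> carrier (poly_ring n)" "q \<in> supp_ideal A"
  shows "p * q \<in> supp_ideal A"
proof -
  have "Poly_Mapping.keys m \<in> A" if "m \<in> Poly_Mapping.keys (p * q)" for m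
  proof -
    from that keys_mult[of p q] obtain a b
      where a: "a \<in> Poly_Mapping.keys p" and b: "b \<in> Poly_Mapping.keys q" and m: "m = a + b"
      by auto
    have "Poly_Mapping.keys a \<subseteq> {1..n}" "Poly_Mapping.keys b \<in> A"
      using a b assms(2,3) by (auto simp: carrier_poly_ring supp_ideal_def)
    moreover from this(2) have "Poly_Mapping.keys b \<subseteq> {1..n}"
      using assms(1) by (auto simp: upclosed_def)
    ultimately show ?thesis
      using assms(1) by (simp add: m keys_nat_add upclosed_def)
  qed
  then show ?thesis by (simp add: supp_ideal_def)
qed

lemma poly_ring_mult_closed:
  "p \<in> carrier (poly_ring n) \<Longrightarrow> q \<in> carrier (poly_ring n) \<Longrightarrow> p * q \<in> carrier (poly_ring n)"
  using supp_ideal_mult[OF upclosed_Pow] by (simp add: carrier_eq_supp_ideal)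

lemma cring_poly_ring: "cring (poly_ring n)"
proof (rule cringI)
  show "abelian_group (poly_ring n)"
  proof (rule abelian_groupI)
    fix x assume "x \<in> carrier (poly_ring n)"
    then show "\<exists>y\<in>carrier (poly_ring n). y \<oplus>\<^bsub>poly_ring n\<^esub> x = \<zero>\<^bsub>poly_ring n\<^esub>"
      by (intro bexI[of _ "- x"]) (auto simp: carrier_eq_supp_ideal supp_ideal_uminus)
  qed (auto simp: carrier_eq_supp_ideal supp_ideal_add add.assoc add.commute)
  have "(1 :: 'a mpoly) \<in> carrier (poly_ring n)"
    by (simp add: carrier_poly_ring)
  then show "comm_monoid (poly_ring n :: 'a mpoly ring)"
    by (unfold_locales) (auto simp: poly_ring_mult_closed mult.assoc mult.commute)
qed (simp add: distrib_right)

lemma ideal_supp_ideal: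
  assumes "upclosed n A"
  shows "ideal (supp_ideal A :: 'k::field mpoly set) (poly_ring n)"
proof -
  interpret cring "poly_ring n :: 'k mpoly ring" by (rule cring_poly_ring)
  have inv: "\<ominus>\<^bsub>poly_ring n\<^esub> x = - x" if "x \<in> carrier (poly_ring n)" for x :: "'k mpoly"
    using that by (intro minus_equality) (auto simp: carrier_eq_supp_ideal supp_ideal_uminus)
  show ?thesis
  proof (rule idealI)
    show "subgroup (supp_ideal A) (add_monoid (poly_ring n) :: 'k mpoly monoid)"
    proof (rule subgroup.intro)
      show "inv\<^bsub>add_monoid (poly_ring n)\<^esub> x \<in> supp_ideal A" if "x \<in> supp_ideal A" for x :: "'k mpoly"
        using that inv[of x] supp_ideal_subset_carrier[OF assms] supp_ideal_uminus[OF that]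
        by (auto simp: a_inv_def)
    qed (use supp_ideal_subset_carrier[OF assms] in \<open>auto simp: supp_ideal_add\<close>)
    show "a \<otimes>\<^bsub>poly_ring n\<^esub> x \<in> supp_ideal A" if "a \<in> supp_ideal A" "x \<in> carrier (poly_ring n)" for a x :: "'k mpoly"
      using supp_ideal_mult[OF assms that(2,1)] by (simp add: mult.commute)
  qed (use ring_axioms in \<open>simp_all add: supp_ideal_mult[OF assms]\<close>)
qed

lemma poly_mapping_sum_single: "p = (\<Sum>m\<in>Poly_Mapping.keys p. Poly_Mapping.single m (Poly_Mapping.lookup p m))"
  by (rule poly_mapping_eqI)
    (auto simp: lookup_sum lookup_single when_def in_keys_iff)

lemma keys_sum_single: "finite \<tau> \<Longrightarrow> Poly_Mapping.keys (\<Sum>i\<in>\<tau>. Poly_Mapping.single i 1 :: nat \<Rightarrow>\<^sub>0 nat) = \<tau>"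
  by (induct rule: finite_induct) (simp_all add: keys_nat_add del: One_nat_def)

lemma mdegree_sum_single: "finite \<tau> \<Longrightarrow> mdegree (\<Sum>i\<in>\<tau>. Poly_Mapping.single i 1) = card \<tau>"
  by (induct rule: finite_induct) (simp_all add: mdegree_add del: One_nat_def)

text \<open>Each monomial of the ideal is a multiple of the squarefree monomial on its own support,
  and that support already belongs to \<open>A\<close>; no minimal generators have to be singled
  out.\<close>

lemma genideal_sqfree_monomial:
  assumes "upclosed n A"
  shows "genideal (poly_ring n) (sqfree_monomial ` A) = (supp_ideal A :: 'k::field mpoly set)"
proof
  interpret cring "poly_ring n :: 'k mpoly ring" by (rule cring_poly_ring)
  have fin: "finite \<tau>" "\<tau> \<subseteq> {1..n}" if "\<tau> \<in> A" for \<tau>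
    using that assms finite_subset[of \<tau> "{1..n}"] by (auto simp: upclosed_def)
  have sub: "sqfree_monomial ` A \<subseteq> (supp_ideal A :: 'k mpoly set)"
    by (auto simp: sqfree_monomial_def supp_ideal_def keys_sum_single fin simp del: One_nat_def)
  then show "genideal (poly_ring n) (sqfree_monomial ` A) \<subseteq> (supp_ideal A :: 'k mpoly set)"
    by (intro genideal_minimal ideal_supp_ideal assms)
  interpret G: ideal "genideal (poly_ring n) (sqfree_monomial ` A :: 'k mpoly set)" "poly_ring n"
    using sub supp_ideal_subset_carrier[OF assms] by (intro genideal_ideal) auto
  have gen: "sqfree_monomial \<tau> \<in> genideal (poly_ring n) (sqfree_monomial ` A :: 'k mpoly set)" if "\<tau> \<in> A" for \<tau>
    using that by (intro genideal_self[THEN subsetD] order.trans[OF sub supp_ideal_subset_carrier[OF assms]]) auto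
  show "supp_ideal A \<subseteq> genideal (poly_ring n) (sqfree_monomial ` A :: 'k mpoly set)"
  proof
    fix p :: "'k mpoly" assume p: "p \<in> supp_ideal A"
    have single: "Poly_Mapping.single m (Poly_Mapping.lookup p m) \<in> genideal (poly_ring n) (sqfree_monomial ` A)"
      if m: "m \<in> Poly_Mapping.keys p" for m
    proof -
      let ?t = "\<Sum>i\<in>Poly_Mapping.keys m. Poly_Mapping.single i 1 :: nat \<Rightarrow>\<^sub>0 nat"
      have A: "Poly_Mapping.keys m \<in> A" using p m by (simp add: supp_ideal_def)
      \<comment> \<open>Truncated subtraction loses nothing: every exponent of \<open>m\<close> on
        its support is at least 1.\<close>
      have "(m - ?t) + ?t = m"
        by (rule poly_mapping_eqI) (auto simp: lookup_add lookup_minus lookup_sum lookup_single when_def in_keys_iff)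
      then have "Poly_Mapping.single m (Poly_Mapping.lookup p m)
          = Poly_Mapping.single (m - ?t) (Poly_Mapping.lookup p m) * sqfree_monomial (Poly_Mapping.keys m)"
        by (simp add: sqfree_monomial_def mult_single)
      moreover have "Poly_Mapping.single (m - ?t) (Poly_Mapping.lookup p m) \<in> carrier (poly_ring n)"
        using fin(2)[OF A] by (auto simp: carrier_poly_ring in_keys_iff lookup_minus)
      ultimately show ?thesis
        using G.I_l_closed[OF gen[OF A]] by simp
    qed
    have "(\<Sum>m\<in>F. Poly_Mapping.single m (Poly_Mapping.lookup p m)) \<in> genideal (poly_ring n) (sqfree_monomial ` A)"
      if "finite F" "F \<subseteq> Poly_Mapping.keys p" for F
      using that
    proof (induction F rule: finite_induct)
      case empty
      show ?case using G.zero_closed by simp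
    next
      case (insert m F)
      then show ?case using G.a_closed single by (simp add: subset_iff)
    qed
    then show "p \<in> genideal (poly_ring n) (sqfree_monomial ` A)"
      by (subst poly_mapping_sum_single) auto
  qed
qed

section \<open>Quotient modules and graded surjections\<close>

text \<open>Every module axiom is transported along a surjection that respects the operations. The
  condition on zero is separate because \<open>B\<close> is not yet known to be a group, so
  additivity does not imply it.\<close>

lemma module_surj_image:
  assumes "module R A" and surj: "f ` carrier A = carrier B"
    and add: "\<And>x y. x \<in> carrier A \<Longrightarrow> y \<in> carrier A \<Longrightarrow> f (x \<oplus>\<^bsub>A\<^esub> y) = f x \<oplus>\<^bsub>B\<^esub> f y"
    and smult: "\<And>r x. r \<in> carrier R \<Longrightarrow> x \<in> carrier A \<Longrightarrow> f (r \<odot>\<^bsub>A\<^esub> x) = r \<odot>\<^bsub>B\<^esub> f x"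
    and zero: "f \<zero>\<^bsub>A\<^esub> = \<zero>\<^bsub>B\<^esub>"
  shows "module R B"
proof -
  interpret A: module R A by fact
  have ball: "(\<forall>v\<in>carrier B. P v) \<longleftrightarrow> (\<forall>x\<in>carrier A. P (f x))" for P
    unfolding surj[symmetric] by blast
  have all: "(\<forall>v. v \<in> carrier B \<longrightarrow> P v) \<longleftrightarrow> (\<forall>x\<in>carrier A. P (f x))" for P
    unfolding surj[symmetric] by blast
  have bex: "(\<exists>v\<in>carrier B. P v) \<longleftrightarrow> (\<exists>x\<in>carrier A. P (f x))" for P
    unfolding surj[symmetric] by blast
  have img: "f x \<in> carrier B" if "x \<in> carrier A" for x
    using that surj by blast
  show ?thesis
  proof (rule module_criteria)
    show "cring R" ..
    show "\<zero>\<^bsub>B\<^esub> \<in> carrier B"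
      using img[OF A.M.zero_closed] zero by simp
    show "\<forall>v w. v \<in> carrier B \<and> w \<in> carrier B \<longrightarrow> v \<oplus>\<^bsub>B\<^esub> w \<in> carrier B"
      unfolding surj[symmetric] by (auto simp flip: add)
    show "\<forall>v\<in>carrier B. \<exists>neg_v\<in>carrier B. v \<oplus>\<^bsub>B\<^esub> neg_v = \<zero>\<^bsub>B\<^esub>"
      unfolding ball bex by (metis A.M.add.inv_closed A.M.r_neg add zero)
    show "\<forall>c v. c \<in> carrier R \<and> v \<in> carrier B \<longrightarrow> c \<odot>\<^bsub>B\<^esub> v \<in> carrier B"
      unfolding surj[symmetric] by (auto simp flip: smult)
    show "\<forall>v w. v \<in> carrier B \<and> w \<in> carrier B \<longrightarrow> v \<oplus>\<^bsub>B\<^esub> w = w \<oplus>\<^bsub>B\<^esub> v"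
      unfolding surj[symmetric] by (auto simp: A.M.a_comm simp flip: add)
    show "\<forall>v w x. v \<in> carrier B \<and> w \<in> carrier B \<and> x \<in> carrier B \<longrightarrow>
        v \<oplus>\<^bsub>B\<^esub> w \<oplus>\<^bsub>B\<^esub> x = v \<oplus>\<^bsub>B\<^esub> (w \<oplus>\<^bsub>B\<^esub> x)"
      unfolding surj[symmetric] by (auto simp: A.M.a_assoc simp flip: add)
    show "\<forall>v\<in>carrier B. v \<oplus>\<^bsub>B\<^esub> \<zero>\<^bsub>B\<^esub> = v"
      unfolding ball zero[symmetric] by (auto simp flip: add)
    show "\<forall>a b v. a \<in> carrier R \<and> b \<in> carrier R \<and> v \<in> carrier B \<longrightarrow>
        a \<otimes>\<^bsub>R\<^esub> b \<odot>\<^bsub>B\<^esub> v = a \<odot>\<^bsub>B\<^esub> (b \<odot>\<^bsub>B\<^esub> v)"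
      unfolding surj[symmetric] by (auto simp: A.smult_assoc1 simp flip: smult)
    show "\<forall>v\<in>carrier B. \<one>\<^bsub>R\<^esub> \<odot>\<^bsub>B\<^esub> v = v"
      unfolding ball by (auto simp flip: smult)
    show "\<forall>a b v. a \<in> carrier R \<and> b \<in> carrier R \<and> v \<in> carrier B \<longrightarrow>
        (a \<oplus>\<^bsub>R\<^esub> b) \<odot>\<^bsub>B\<^esub> v = a \<odot>\<^bsub>B\<^esub> v \<oplus>\<^bsub>B\<^esub> b \<odot>\<^bsub>B\<^esub> v"
      unfolding surj[symmetric] by (auto simp: A.smult_l_distr simp flip: smult add)
    show "\<forall>a v w. a \<in> carrier R \<and> v \<in> carrier B \<and> w \<in> carrier B \<longrightarrow>
        a \<odot>\<^bsub>B\<^esub> (v \<oplus>\<^bsub>B\<^esub> w) = a \<odot>\<^bsub>B\<^esub> v \<oplus>\<^bsub>B\<^esub> a \<odot>\<^bsub>B\<^esub> w"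
      unfolding surj[symmetric] by (auto simp: A.smult_r_distr simp flip: smult add)
  qed
qed

context
  fixes R :: "('a, 'r) ring_scheme" and A :: "('a, 'b, 'c) module_scheme" and K :: "'b set"
  assumes modA: "module R A" and subK: "submodule R K A"
begin

interpretation A: module R A by (rule modA)
interpretation K: submodule R K A by (rule subK)

lemma abelian_subgroup_submodule: "abelian_subgroup K A"
proof (intro abelian_subgroupI3 additive_subgroup.intro subgroup.intro)
  show "inv\<^bsub>add_monoid A\<^esub> x \<in> K" if "x \<in> K" for x
    using K.smult_closed[of "\<ominus>\<^bsub>R\<^esub> \<one>\<^bsub>R\<^esub>" x] that subsetD[OF K.subset that]
    by (simp add: A.smult_l_minus flip: a_inv_def)
qed (use K.subset in \<open>auto intro: A.M.abelian_group_axioms\<close>)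

interpretation S: abelian_subgroup K A by (rule abelian_subgroup_submodule)

lemma coset_eq_iff:
  assumes "x \<in> carrier A" "y \<in> carrier A"
  shows "K +>\<^bsub>A\<^esub> x = K +>\<^bsub>A\<^esub> y \<longleftrightarrow> x \<ominus>\<^bsub>A\<^esub> y \<in> K"
  using S.a_rcos_module[OF assms(2,1)] S.a_repr_independence' S.a_repr_independenceD assms
  unfolding a_minus_def by metis

lemma coset_zero: "K +>\<^bsub>A\<^esub> \<zero>\<^bsub>A\<^esub> = K"
  using K.subset by simp

lemma coset_eq_self_iff: "x \<in> carrier A \<Longrightarrow> K +>\<^bsub>A\<^esub> x = K \<longleftrightarrow> x \<in> K"
  using A.M.a_coset_join1[OF _ _ S.a_subgroup] A.M.a_coset_join2[OF _ S.a_subgroup] by blast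

text \<open>Collapses the union by which \<open>quotient_module\<close> defines its action: two
  representatives differ by an element of \<open>K\<close>, and \<open>K\<close> absorbs
  scalars.\<close>

lemma coset_smult:
  assumes "r \<in> carrier R" "x \<in> carrier A"
  shows "(\<Union>z\<in>K +>\<^bsub>A\<^esub> x. K +>\<^bsub>A\<^esub> (r \<odot>\<^bsub>A\<^esub> z)) = K +>\<^bsub>A\<^esub> (r \<odot>\<^bsub>A\<^esub> x)"
proof -
  have "K +>\<^bsub>A\<^esub> (r \<odot>\<^bsub>A\<^esub> z) = K +>\<^bsub>A\<^esub> (r \<odot>\<^bsub>A\<^esub> x)" if z: "z \<in> K +>\<^bsub>A\<^esub> x" for z
  proof -
    obtain k where k: "k \<in> K" "z = k \<oplus>\<^bsub>A\<^esub> x"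
      using z by (auto simp: a_r_coset_def')
    then have "k \<in> carrier A" using K.subset by auto
    then have "r \<odot>\<^bsub>A\<^esub> z \<ominus>\<^bsub>A\<^esub> r \<odot>\<^bsub>A\<^esub> x = r \<odot>\<^bsub>A\<^esub> k"
      using assms k by (simp add: A.smult_r_distr a_minus_def A.M.a_assoc A.M.r_neg)
    then show ?thesis
      using assms k \<open>k \<in> carrier A\<close> by (subst coset_eq_iff) auto
  qed
  then have "\<forall>z\<in>K +>\<^bsub>A\<^esub> x. K +>\<^bsub>A\<^esub> (r \<odot>\<^bsub>A\<^esub> z) = K +>\<^bsub>A\<^esub> (r \<odot>\<^bsub>A\<^esub> x)" ..
  with S.a_rcos_self[OF assms(2)] show ?thesis
    by (rule UN_constant_eq)
qed

end

lemma quotient_module_hom: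
  assumes "module R A" "submodule R K A"
  shows "(\<lambda>x. K +>\<^bsub>A\<^esub> x) \<in> module_hom R A (quotient_module A K)"
    and "carrier (quotient_module A K) = (\<lambda>x. K +>\<^bsub>A\<^esub> x) ` carrier A"
  by (auto simp: module_hom_def quotient_module_def A_RCOSETS_def' coset_smult[OF assms]
      abelian_subgroup.a_rcos_sum[OF abelian_subgroup_submodule[OF assms]])

lemma module_quotient:
  assumes "module R A" "submodule R K A"
  shows "module R (quotient_module A K)"
  using quotient_module_hom[OF assms]
  by (intro module_surj_image[OF assms(1), of "\<lambda>x. K +>\<^bsub>A\<^esub> x"])
    (auto simp: module_hom_def coset_zero[OF assms] quotient_module_def)

text \<open>M, N/K, N/\<Theta>N and M/\<Theta>M are all images of N in this sense, so isomorphisms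
  and dimensions among them reduce to comparing kernels inside N.\<close>

definition graded_surj ::
  "('a, 'r) ring_scheme \<Rightarrow> ('a, 'b, 'c) graded_module_scheme
    \<Rightarrow> ('a, 'd, 'e) graded_module_scheme \<Rightarrow> ('b \<Rightarrow> 'd) \<Rightarrow> bool" where
  "graded_surj R A B f \<longleftrightarrow> module R A \<and> module R B \<and> f \<in> module_hom R A B \<and>
    f ` carrier A = carrier B \<and> (\<forall>d. f ` piece A d = piece B d)"

lemma graded_surj_mod_hom: "graded_surj R A B f \<Longrightarrow> mod_hom R A B f"
  by (simp add: graded_surj_def mod_hom_def mod_hom_axioms_def)

lemma graded_surj_quotient:
  assumes "module R A" "submodule R K A"
  shows "graded_surj R A (quotient_module A K) (\<lambda>x. K +>\<^bsub>A\<^esub> x)"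
  unfolding graded_surj_def
proof (intro conjI allI)
  show "(\<lambda>x. K +>\<^bsub>A\<^esub> x) ` piece A d = piece (quotient_module A K) d" for d
    by (simp add: quotient_module_def)
qed (use assms module_quotient[OF assms] quotient_module_hom[OF assms] in auto)

lemma graded_surj_comp:
  assumes "graded_surj R A B f" "graded_surj R B C g"
  shows "graded_surj R A C (\<lambda>x. g (f x))"
  using assms unfolding graded_surj_def module_hom_def
  by (auto simp: Pi_iff simp flip: image_image[of g f])

section \<open>Graded pieces as vector spaces over k\<close>

lemma const_carrier: "Poly_Mapping.single 0 c \<in> carrier (poly_ring n)"
  by (auto simp: carrier_poly_ring)

text \<open>The record leaves \<open>piece\<close> unconstrained; this supplies what is needed of
  the source of a graded surjection.\<close>

definition vs_pieces :: "('k::field mpoly, 'b, 'c) graded_module_scheme \<Rightarrow> bool" where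
  "vs_pieces A \<longleftrightarrow> (\<forall>d. piece A d \<subseteq> carrier A \<and> vectorspace class_ring (piece_space A d))"

text \<open>The pieces of \<open>B\<close> inherit the vector space axioms as images of those of
  \<open>A\<close>, so nothing has to be assumed about them.\<close>

lemma
  assumes "graded_surj (poly_ring n) A B f" "vs_pieces A"
  shows linear_map_pieces: "linear_map class_ring (piece_space A d) (piece_space B d) f"
    and piece_surj: "f ` carrier (piece_space A d) = carrier (piece_space B d)"
proof -
  have hom: "f \<in> module_hom (poly_ring n) A B" and img: "f ` carrier A = carrier B"
      "\<And>d. f ` piece A d = piece B d"
    using assms(1) by (auto simp: graded_surj_def)
  have pc: "piece A d \<subseteq> carrier A" and vs: "vectorspace class_ring (piece_space A d)" for d
    using assms(2) by (auto simp: vs_pieces_def)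
  have [simp]: "x \<in> carrier A" if "x \<in> piece A d" for x d
    using that pc by blast
  interpret mod_hom "poly_ring n" A B f by (rule graded_surj_mod_hom) fact
  have 1: "f (x \<oplus>\<^bsub>piece_space A d\<^esub> y) = f x \<oplus>\<^bsub>piece_space B d\<^esub> f y"
    if "x \<in> carrier (piece_space A d)" "y \<in> carrier (piece_space A d)" for x y d
    using that pc[of d] by (auto simp: piece_space_def)
  have 2: "f (c \<odot>\<^bsub>piece_space A d\<^esub> x) = c \<odot>\<^bsub>piece_space B d\<^esub> f x"
    if "x \<in> carrier (piece_space A d)" for c x d
    using that pc[of d] by (auto simp: piece_space_def const_carrier)
  show 3: "f ` carrier (piece_space A d) = carrier (piece_space B d)" for d
    by (simp add: piece_space_def img)
  have 4: "vectorspace class_ring (piece_space B d)" for d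
    unfolding vectorspace_def
  proof
    show "module class_ring (piece_space B d)"
      using vs[of d]
      by (intro module_surj_image[of class_ring "piece_space A d" f] 1 2 3)
        (auto simp: vectorspace_def piece_space_def)
  qed (rule class_field)
  show "linear_map class_ring (piece_space A d) (piece_space B d) f"
  proof -
    have "f \<in> module_hom class_ring (piece_space A d) (piece_space B d)"
      unfolding module_hom_def 3[symmetric] using 1 2 by simp
    then show ?thesis
      using vs[of d] 4[of d]
      by (simp add: linear_map_def mod_hom_def vectorspace_def mod_hom_axioms_def)
  qed
qed

text \<open>Since the kernel of \<open>T1\<close> lies in that of \<open>T2\<close>, the map
  \<open>T2\<close> factors through \<open>T1\<close>. Rank-nullity for the induced surjection gives
  the inequality, and equality means that this surjection is injective, that is, that the two
  kernels agree.\<close>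

lemma dim_surj_le:
  assumes "linear_map K V W1 T1" "T1 ` carrier V = carrier W1" "vectorspace.fin_dim K V"
    and "linear_map K V W2 T2" "T2 ` carrier V = carrier W2"
    and ker: "\<And>v. v \<in> carrier V \<Longrightarrow> T1 v = \<zero>\<^bsub>W1\<^esub> \<Longrightarrow> T2 v = \<zero>\<^bsub>W2\<^esub>"
  shows "vectorspace.dim K W2 \<le> vectorspace.dim K W1"
    and "vectorspace.dim K W2 = vectorspace.dim K W1 \<longleftrightarrow>
      (\<forall>v\<in>carrier V. T2 v = \<zero>\<^bsub>W2\<^esub> \<longrightarrow> T1 v = \<zero>\<^bsub>W1\<^esub>)"
proof -
  interpret T1: linear_map K V W1 T1 by fact
  interpret T2: linear_map K V W2 T2 by fact
  \<comment> \<open>A section of \<open>T1\<close> followed by \<open>T2\<close>; the choice of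
    preimage does not matter because of \<open>ker\<close>.\<close>
  define T where "T = (\<lambda>w. T2 (SOME v. v \<in> carrier V \<and> T1 v = w))"
  have T: "T (T1 v) = T2 v" if "v \<in> carrier V" for v
  proof -
    define u where "u = (SOME u. u \<in> carrier V \<and> T1 u = T1 v)"
    have u: "u \<in> carrier V" "T1 u = T1 v"
      using someI[of "\<lambda>u. u \<in> carrier V \<and> T1 u = T1 v" v] that by (auto simp: u_def)
    then have "T1 (u \<ominus>\<^bsub>V\<^esub> v) = \<zero>\<^bsub>W1\<^esub>"
      using that by (simp add: T1.W.module.M.minus_other_side)
    then have "T2 u \<ominus>\<^bsub>W2\<^esub> T2 v = \<zero>\<^bsub>W2\<^esub>"
      using ker[of "u \<ominus>\<^bsub>V\<^esub> v"] u that by simp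
    then show ?thesis
      using u that by (simp add: T_def flip: u_def T2.W.module.M.minus_other_side)
  qed
  have T_add: "T (T1 x \<oplus>\<^bsub>W1\<^esub> T1 y) = T2 x \<oplus>\<^bsub>W2\<^esub> T2 y" if "x \<in> carrier V" "y \<in> carrier V" for x y
    using T[of "x \<oplus>\<^bsub>V\<^esub> y"] that by simp
  have T_smult: "T (c \<odot>\<^bsub>W1\<^esub> T1 x) = c \<odot>\<^bsub>W2\<^esub> T2 x" if "c \<in> carrier K" "x \<in> carrier V" for c x
    using T[of "c \<odot>\<^bsub>V\<^esub> x"] that by simp
  interpret T: linear_map K W1 W2 T
  proof
    show "T \<in> module_hom K W1 W2"
      unfolding module_hom_def assms(2)[symmetric] by (auto simp: T T_add T_smult)
  qed
  have surj: "T ` carrier W1 = carrier W2"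
    unfolding assms(2,5)[symmetric] image_image by (intro image_cong refl T)
  have fd: "T1.W.fin_dim"
    using T1.surj_fin_dim assms by blast
  have rn: "T2.W.dim + vectorspace.dim K (W1\<lparr>carrier := T.ker\<rparr>) = T1.W.dim"
    using T.rank_nullity[OF fd] T.surj_imp_imT_carrier[OF surj] by simp
  then show "T2.W.dim \<le> T1.W.dim" by linarith
  have kerT: "T.ker = {\<zero>\<^bsub>W1\<^esub>} \<longleftrightarrow> (\<forall>v\<in>carrier V. T2 v = \<zero>\<^bsub>W2\<^esub> \<longrightarrow> T1 v = \<zero>\<^bsub>W1\<^esub>)"
  proof -
    have "T.ker = {\<zero>\<^bsub>W1\<^esub>} \<longleftrightarrow> (\<forall>w\<in>carrier W1. T w = \<zero>\<^bsub>W2\<^esub> \<longrightarrow> w = \<zero>\<^bsub>W1\<^esub>)"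
      unfolding T.ker_def using T1.W.module.M.zero_closed T.f0_is_0 by blast
    then show ?thesis
      unfolding assms(2)[symmetric] by (simp add: T)
  qed
  interpret ker: vectorspace K "W1\<lparr>carrier := T.ker\<rparr>"
    using T.kerT_is_subspace T1.W.subspace_is_vs by blast
  have "ker.dim = 0 \<longleftrightarrow> T.ker = {\<zero>\<^bsub>W1\<^esub>}"
  proof
    assume "T.ker = {\<zero>\<^bsub>W1\<^esub>}"
    then show "ker.dim = 0"
      using T.inj_imp_dim_ker0 T.Ke0_imp_inj by simp
  next
    assume dim0: "ker.dim = 0"
    \<comment> \<open>\<open>dim\<close> is informative only once a finite basis exists. Independent
      sets in the kernel remain independent in \<open>W1\<close>, so their sizes are bounded and a
      maximal one is a basis.\<close>
    have "finite S \<and> card S \<le> T1.W.dim" if "S \<subseteq> T.ker" "ker.lin_indpt S" for S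
    proof -
      have "\<not> module.lin_dep K W1 S"
        using that T1.W.module.span_li_not_depend(2)[of S T.ker] T.ker_is_submodule by simp
      moreover have "S \<subseteq> carrier W1" using that(1) by (auto simp: T.ker_def)
      ultimately show ?thesis using T1.W.li_le_dim[OF fd] by blast
    qed
    then have "\<exists>B. finite B \<and> maximal B (\<lambda>S. S \<subseteq> carrier (W1\<lparr>carrier := T.ker\<rparr>) \<and> ker.lin_indpt S)"
      by (intro maximal_exists[where N = T1.W.dim and B = "{}"]) (auto simp: ker.lin_dep_def)
    then obtain B where "finite B" "ker.basis B"
      using ker.max_li_is_basis by auto
    then have "B = {}" using ker.dim_basis[of B] dim0 by simp
    then show "T.ker = {\<zero>\<^bsub>W1\<^esub>}"
      using \<open>ker.basis B\<close> ker.span_empty by (simp add: ker.basis_def)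
  qed
  then show "T2.W.dim = T1.W.dim \<longleftrightarrow> (\<forall>v\<in>carrier V. T2 v = \<zero>\<^bsub>W2\<^esub> \<longrightarrow> T1 v = \<zero>\<^bsub>W1\<^esub>)"
    using rn kerT by auto
qed

section \<open>The submodule generated by a sequence\<close>

lemma seq_mult_gens_subset:
  "module R A \<Longrightarrow> set \<Theta> \<subseteq> carrier R \<Longrightarrow>
    {\<theta> \<odot>\<^bsub>A\<^esub> x | \<theta> x. \<theta> \<in> set \<Theta> \<and> x \<in> carrier A} \<subseteq> carrier A"
  by (auto intro: module.smult_closed)

lemma submodule_seq_mult:
  "module R A \<Longrightarrow> set \<Theta> \<subseteq> carrier R \<Longrightarrow> submodule R (seq_mult R \<Theta> A) A"
  unfolding seq_mult_def by (intro module.span_is_submodule seq_mult_gens_subset)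

lemma seq_mult_Nil: 
  assumes "module R A"
  shows "seq_mult R [] A = {\<zero>\<^bsub>A\<^esub>}"
proof -
  interpret module R A by fact
  show ?thesis by (auto simp: seq_mult_def span_def lincomb_def)
qed

text \<open>The span grows by one summand per form, which permits induction along the sequence. The
  multiples of a single \<theta> already form a submodule because \<open>R\<close> is
  commutative.\<close>

lemma seq_mult_snoc:
  assumes "module R A" "set \<Theta> \<subseteq> carrier R" "\<theta> \<in> carrier R"
  shows "seq_mult R (\<Theta> @ [\<theta>]) A = {x \<oplus>\<^bsub>A\<^esub> \<theta> \<odot>\<^bsub>A\<^esub> y | x y. x \<in> seq_mult R \<Theta> A \<and> y \<in> carrier A}"
    (is "?L = ?R")
proof
  interpret module R A by fact
  interpret S: submodule R "seq_mult R \<Theta> A" A by (rule submodule_seq_mult) fact+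
  interpret L: submodule R ?L A by (rule submodule_seq_mult) (use assms in auto)
  have gen: "\<theta>' \<odot>\<^bsub>A\<^esub> y \<in> seq_mult R \<Theta> A" if "\<theta>' \<in> set \<Theta>" "y \<in> carrier A" for \<theta>' y
    using that in_own_span[OF seq_mult_gens_subset[OF assms(1,2)]] unfolding seq_mult_def by blast
  have genL: "\<theta>' \<odot>\<^bsub>A\<^esub> y \<in> ?L" if "\<theta>' \<in> set (\<Theta> @ [\<theta>])" "y \<in> carrier A" for \<theta>' y
  proof -
    have "set (\<Theta> @ [\<theta>]) \<subseteq> carrier R" using assms by auto
    from in_own_span[OF seq_mult_gens_subset[OF assms(1) this]] show ?thesis
      unfolding seq_mult_def using that by blast
  qed
  have car: "x \<in> carrier A" if "x \<in> seq_mult R \<Theta> A" for x using that S.subset by auto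
  have "submodule R ?R A"
  proof
    show "v \<oplus>\<^bsub>A\<^esub> w \<in> ?R" if vw: "v \<in> ?R" "w \<in> ?R" for v w
    proof -
      obtain x y x' y' where xy: "v = x \<oplus>\<^bsub>A\<^esub> \<theta> \<odot>\<^bsub>A\<^esub> y" "x \<in> seq_mult R \<Theta> A" "y \<in> carrier A"
         "w = x' \<oplus>\<^bsub>A\<^esub> \<theta> \<odot>\<^bsub>A\<^esub> y'" "x' \<in> seq_mult R \<Theta> A" "y' \<in> carrier A"
        using vw by blast
      then have "v \<oplus>\<^bsub>A\<^esub> w = (x \<oplus>\<^bsub>A\<^esub> x') \<oplus>\<^bsub>A\<^esub> \<theta> \<odot>\<^bsub>A\<^esub> (y \<oplus>\<^bsub>A\<^esub> y')"
        using car assms by (simp add: smult_r_distr M.a_ac)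
      then show ?thesis using xy by blast
    qed
    show "c \<odot>\<^bsub>A\<^esub> v \<in> ?R" if v: "v \<in> ?R" and c: "c \<in> carrier R" for c v
    proof -
      obtain x y where xy: "v = x \<oplus>\<^bsub>A\<^esub> \<theta> \<odot>\<^bsub>A\<^esub> y" "x \<in> seq_mult R \<Theta> A" "y \<in> carrier A"
        using v by blast
      then have "c \<odot>\<^bsub>A\<^esub> v = c \<odot>\<^bsub>A\<^esub> x \<oplus>\<^bsub>A\<^esub> \<theta> \<odot>\<^bsub>A\<^esub> (c \<odot>\<^bsub>A\<^esub> y)"
        using car assms c by (simp add: smult_r_distr R.m_comm flip: smult_assoc1)
      then show ?thesis using xy c by blast
    qed
    have "\<zero>\<^bsub>A\<^esub> = \<zero>\<^bsub>A\<^esub> \<oplus>\<^bsub>A\<^esub> \<theta> \<odot>\<^bsub>A\<^esub> \<zero>\<^bsub>A\<^esub>" using assms by simp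
    then show "\<zero>\<^bsub>A\<^esub> \<in> ?R" using S.zero_closed by blast
  qed (use car assms in auto)
  moreover have "{\<theta>' \<odot>\<^bsub>A\<^esub> x |\<theta>' x. \<theta>' \<in> set (\<Theta> @ [\<theta>]) \<and> x \<in> carrier A} \<subseteq> ?R"
  proof clarify
    fix \<theta>' x assume *: "\<theta>' \<in> set (\<Theta> @ [\<theta>])" "x \<in> carrier A"
    show "\<exists>u v. \<theta>' \<odot>\<^bsub>A\<^esub> x = u \<oplus>\<^bsub>A\<^esub> \<theta> \<odot>\<^bsub>A\<^esub> v \<and> u \<in> seq_mult R \<Theta> A \<and> v \<in> carrier A"
    proof (cases "\<theta>' \<in> set \<Theta>")
      case True
      then show ?thesis using gen[OF True *(2)] assms car[OF gen[OF True *(2)]]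
        by (intro exI[of _ "\<theta>' \<odot>\<^bsub>A\<^esub> x"] exI[of _ "\<zero>\<^bsub>A\<^esub>"]) simp
    next
      case False
      then show ?thesis using * assms S.zero_closed
        by (intro exI[of _ "\<zero>\<^bsub>A\<^esub>"] exI[of _ x]) auto
    qed
  qed
  ultimately show "?L \<subseteq> ?R"
    unfolding seq_mult_def[of R "\<Theta> @ [\<theta>]"] by (rule span_is_subset[rotated])
  have "seq_mult R \<Theta> A \<subseteq> ?L"
    unfolding seq_mult_def by (rule span_is_monotone) auto
  then show "?R \<subseteq> ?L"
    using genL by (auto intro!: L.m_closed)
qed

text \<open>In particular \<Theta>M is the image of \<Theta>N, so membership in it can be studied on
  representatives in N.\<close>

lemma seq_mult_image:
  assumes "mod_hom R A B f" "f ` carrier A = carrier B" "set \<Theta> \<subseteq> carrier R"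
  shows "seq_mult R \<Theta> B = f ` seq_mult R \<Theta> A"
  using assms(3)
proof (induction \<Theta> rule: rev_induct)
  interpret mod_hom R A B f by fact
  {
    case Nil
    show ?case by (simp add: seq_mult_Nil M.module_axioms N.module_axioms)
  next
    case (snoc \<theta> \<Theta>)
    then have \<Theta>: "set \<Theta> \<subseteq> carrier R" "\<theta> \<in> carrier R" by auto
    interpret S: submodule R "seq_mult R \<Theta> A" A
      using \<Theta> by (intro submodule_seq_mult M.module_axioms)
    have [simp]: "x \<in> carrier A" if "x \<in> seq_mult R \<Theta> A" for x using that S.subset by auto
    have "f ` seq_mult R (\<Theta> @ [\<theta>]) A
      = (\<lambda>(x, y). f (x \<oplus>\<^bsub>A\<^esub> \<theta> \<odot>\<^bsub>A\<^esub> y)) ` (seq_mult R \<Theta> A \<times> carrier A)"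
      by (force simp: seq_mult_snoc[OF M.module_axioms \<Theta>] image_def)
    also have "\<dots> = (\<lambda>(x, y). f x \<oplus>\<^bsub>B\<^esub> \<theta> \<odot>\<^bsub>B\<^esub> f y) ` (seq_mult R \<Theta> A \<times> carrier A)"
      using \<Theta> by (intro image_cong) auto
    also have "\<dots> = {x \<oplus>\<^bsub>B\<^esub> \<theta> \<odot>\<^bsub>B\<^esub> y | x y. x \<in> f ` seq_mult R \<Theta> A \<and> y \<in> f ` carrier A}"
      by (force simp: image_def)
    finally show ?case
      by (simp add: seq_mult_snoc[OF N.module_axioms \<Theta>] assms(2) snoc.IH[OF \<Theta>(1)])
  }
qed

section \<open>Krull dimension of quotients of the polynomial ring\<close>

abbreviation cscale :: "'k::field \<Rightarrow> 'k mpoly \<Rightarrow> 'k mpoly" where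
  "cscale c p \<equiv> Poly_Mapping.single 0 c * p"

interpretation mpoly: vector_space cscale
proof
  fix a b :: "'a::field" and x y :: "'a mpoly"
  show "cscale a (x + y) = cscale a x + cscale a y" by (simp add: distrib_left)
  show "cscale (a + b) x = cscale a x + cscale b x" by (simp add: single_add distrib_right)
  show "cscale a (cscale b x) = cscale (a * b) x" by (simp add: mult_single flip: mult.assoc)
  show "cscale 1 x = x" by simp
qed

lemma lookup_cscale: "Poly_Mapping.lookup (cscale c p) m = c * Poly_Mapping.lookup p m"
  by (simp add: map.rep_eq when_def flip: mult_map_scale_conv_mult)

lemma poly_ring_sum_closed:
  "(\<And>x. x \<in> F \<Longrightarrow> f x \<in> carrier (poly_ring n)) \<Longrightarrow> sum f F \<in> carrier (poly_ring n)"
  unfolding carrier_eq_supp_ideal by (rule supp_ideal_sum)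

lemma
  assumes "ideal P (poly_ring n :: 'k::field mpoly ring)"
  shows ideal_poly_carrier: "P \<subseteq> carrier (poly_ring n)"
    and ideal_poly_add: "p \<in> P \<Longrightarrow> q \<in> P \<Longrightarrow> p + q \<in> P"
    and ideal_poly_mult: "r \<in> carrier (poly_ring n) \<Longrightarrow> p \<in> P \<Longrightarrow> r * p \<in> P"
    and ideal_poly_diff: "p \<in> P \<Longrightarrow> q \<in> P \<Longrightarrow> p - q \<in> P"
    and ideal_poly_zero: "0 \<in> P"
proof -
  interpret ideal P "poly_ring n" by fact
  show "P \<subseteq> carrier (poly_ring n)" by (rule a_subset)
  show add: "p + q \<in> P" if "p \<in> P" "q \<in> P" for p q
    using additive_subgroup.a_closed[OF is_additive_subgroup that] by simp
  show mult: "r * p \<in> P" if "r \<in> carrier (poly_ring n)" "p \<in> P" for r p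
    using I_l_closed[OF that(2,1)] by simp
  have "cscale (- 1) q \<in> P" if "q \<in> P" for q
    using mult[OF const_carrier that] .
  then show "p - q \<in> P" if "p \<in> P" "q \<in> P"
    using add[of p "cscale (-1) q"] that by (simp add: single_uminus)
  show "0 \<in> P" using additive_subgroup.zero_closed[OF is_additive_subgroup] by simp
qed

lemma
  assumes "primeideal P (poly_ring n)"
  shows primeideal_poly_ideal: "ideal P (poly_ring n)"
    and primeideal_poly_mult: "p \<in> carrier (poly_ring n) \<Longrightarrow> q \<in> carrier (poly_ring n) \<Longrightarrow> p * q \<in> P \<Longrightarrow> p \<in> P \<or> q \<in> P"
    and primeideal_poly_one: "1 \<notin> P"
proof -
  interpret primeideal P "poly_ring n" by fact
  show "ideal P (poly_ring n)" by (rule is_ideal)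
  show "p \<in> P \<or> q \<in> P" if "p \<in> carrier (poly_ring n)" "q \<in> carrier (poly_ring n)" "p * q \<in> P"
    using I_prime[OF that(1,2)] that(3) by simp
  show "1 \<notin> P" using I_notcarr one_imp_carrier by auto
qed

text \<open>Linear independence over k of the classes of \<open>B\<close> in the quotient by
  \<open>P\<close>, stated on representatives; distinct members of \<open>B\<close> then have
  distinct classes.\<close>

definition indep_mod :: "'k::field mpoly set \<Rightarrow> 'k mpoly set \<Rightarrow> bool" where
  "indep_mod P B \<longleftrightarrow> finite B \<and> (\<forall>c. (\<Sum>b\<in>B. cscale (c b) b) \<in> P \<longrightarrow> (\<forall>b\<in>B. c b = 0))"

lemma indep_mod_one:
  assumes "primeideal P (poly_ring n)"
  shows "indep_mod P {1}"
proof -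
  note P = primeideal_poly_ideal[OF assms]
  have "c = 0" if "Poly_Mapping.single 0 c \<in> P" for c
  proof (rule ccontr)
    assume "c \<noteq> 0"
    then have "Poly_Mapping.single 0 (inverse c) * Poly_Mapping.single 0 c = (1 :: 'a mpoly)"
      by (simp add: mult_single)
    then show False
      using ideal_poly_mult[OF P const_carrier that] primeideal_poly_one[OF assms] by metis
  qed
  then show ?thesis by (simp add: indep_mod_def)
qed

text \<open>Let a combination of the union lie in \<open>P\<close>. Modulo \<open>Q\<close> the part
  from \<open>B'\<close> vanishes, since \<open>f\<close> is in \<open>Q\<close>, so the
  coefficients on \<open>B\<close> are zero. What remains is \<open>f\<close> times a combination of
  \<open>B'\<close>; primeness of \<open>P\<close> cancels \<open>f\<close>, and independence modulo
  \<open>P\<close> finishes.\<close>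

lemma indep_mod_union:
  assumes P: "primeideal P (poly_ring n)" and Q: "ideal Q (poly_ring n)" and "P \<subseteq> Q"
    and f: "f \<in> Q" "f \<notin> P"
    and B: "indep_mod Q B" "B \<subseteq> carrier (poly_ring n)"
    and B': "indep_mod P B'" "B' \<subseteq> carrier (poly_ring n)"
  shows "indep_mod P (B \<union> (*) f ` B')" and "card (B \<union> (*) f ` B') = card B + card B'"
proof -
  note Pi = primeideal_poly_ideal[OF P]
  have fin: "finite B" "finite B'" using B B' by (auto simp: indep_mod_def)
  have "f \<noteq> 0" using f ideal_poly_zero[OF Pi] by auto
  then have inj: "inj_on ((*) f) B'" by (auto simp: inj_on_def)
  have fC: "f \<in> carrier (poly_ring n)" using f ideal_poly_carrier[OF Q] by auto
  have fQ: "f * p \<in> Q" if "p \<in> carrier (poly_ring n)" for p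
    using ideal_poly_mult[OF Q that f(1)] by (simp add: mult.commute)
  have "b \<notin> Q" if "b \<in> B" for b
  proof
    assume "b \<in> Q"
    have "(\<Sum>x\<in>B. cscale (if x = b then 1 else 0) x) = (\<Sum>x\<in>B. if x = b then x else 0)"
      by (intro sum.cong) auto
    also have "\<dots> = b" using that fin by simp
    finally have "(\<Sum>x\<in>B. cscale (if x = b then 1 else 0) x) \<in> Q" using \<open>b \<in> Q\<close> by simp
    with B(1) have "\<forall>x\<in>B. (if x = b then 1 else 0 :: 'a) = 0"
      unfolding indep_mod_def by (elim conjE allE impE) 
    then show False using that by auto
  qed
  then have disj: "B \<inter> (*) f ` B' = {}" using fQ B'(2) by auto
  show "card (B \<union> (*) f ` B') = card B + card B'"
    using fin disj inj by (simp add: card_Un_disjoint card_image)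
  show "indep_mod P (B \<union> (*) f ` B')"
    unfolding indep_mod_def
  proof (intro conjI allI impI)
    show "finite (B \<union> (*) f ` B')" using fin by simp
    fix c assume c: "(\<Sum>b\<in>B \<union> (*) f ` B'. cscale (c b) b) \<in> P"
    define s where "s = (\<Sum>b\<in>B'. cscale (c (f * b)) b)"
    have sC: "s \<in> carrier (poly_ring n)"
      unfolding s_def using B'(2) by (intro poly_ring_sum_closed poly_ring_mult_closed const_carrier) auto
    have eq: "(\<Sum>b\<in>B \<union> (*) f ` B'. cscale (c b) b) = (\<Sum>b\<in>B. cscale (c b) b) + f * s"
      using fin disj by (simp add: sum.union_disjoint sum.reindex[OF inj] s_def sum_distrib_left mult.left_commute)
    have "(\<Sum>b\<in>B. cscale (c b) b) = (\<Sum>b\<in>B \<union> (*) f ` B'. cscale (c b) b) - f * s"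
      unfolding eq by simp
    also have "\<dots> \<in> Q"
      using c assms(3) fQ[OF sC] by (intro ideal_poly_diff[OF Q]) auto
    finally have c0: "\<forall>b\<in>B. c b = 0"
      using B(1) by (auto simp: indep_mod_def)
    then have "f * s \<in> P" using c eq by simp
    then have "s \<in> P" using primeideal_poly_mult[OF P fC sC] f by auto
    then have "\<forall>b\<in>B'. c (f * b) = 0"
      using B'(1) unfolding s_def indep_mod_def by (elim conjE allE[of _ "\<lambda>b. c (f * b)"] impE)
    with c0 show "\<forall>b\<in>B \<union> (*) f ` B'. c b = 0" by auto
  qed
qed

section \<open>Counting independent polynomials of bounded degree\<close>

definition deg_le :: "nat \<Rightarrow> nat \<Rightarrow> 'k::field mpoly set" where
  "deg_le n D = {p \<in> carrier (poly_ring n). \<forall>m\<in>Poly_Mapping.keys p. mdegree m \<le> D}"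

lemma deg_le_mono: "D \<le> D' \<Longrightarrow> deg_le n D \<subseteq> deg_le n D'"
  by (force simp: deg_le_def)

lemma deg_le_mult:
  assumes "p \<in> deg_le n D" "q \<in> deg_le n D'"
  shows "p * q \<in> deg_le n (D + D')"
proof -
  have "mdegree m \<le> D + D'" if "m \<in> Poly_Mapping.keys (p * q)" for m
    using that keys_mult[of p q] assms by (force simp: deg_le_def mdegree_add intro: add_mono)
  then show ?thesis using assms poly_ring_mult_closed by (auto simp: deg_le_def)
qed

lemma exists_deg_le: "p \<in> carrier (poly_ring n) \<Longrightarrow> \<exists>D. p \<in> deg_le n D"
  by (intro exI[of _ "Max (mdegree ` Poly_Mapping.keys p)"]) (auto simp: deg_le_def)

text \<open>A crude count, but only its order of growth matters: polynomial in \<open>D\<close> of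
  degree \<open>n\<close>.\<close>

lemma card_monomials_le:
  fixes n D :: nat
  defines "Mon \<equiv> {m. Poly_Mapping.keys m \<subseteq> {1..n} \<and> mdegree m \<le> D}"
  shows "finite Mon" and "card Mon \<le> (D + 1) ^ n"
proof -
  let ?F = "\<lambda>m. restrict (Poly_Mapping.lookup m) {1..n}"
  have inj: "inj_on ?F Mon"
  proof (rule inj_onI)
    fix m m' assume m: "m \<in> Mon" "m' \<in> Mon" and eq: "?F m = ?F m'"
    show "m = m'"
    proof (rule poly_mapping_eqI)
      fix i
      show "Poly_Mapping.lookup m i = Poly_Mapping.lookup m' i"
      proof (cases "i \<in> {1..n}")
        case True
        then show ?thesis using fun_cong[OF eq, of i] by simp
      next
        case False
        then have "i \<notin> Poly_Mapping.keys m" "i \<notin> Poly_Mapping.keys m'"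
          using m by (auto simp: Mon_def)
        then show ?thesis by (simp add: in_keys_iff)
      qed
    qed
  qed
  have lookup_le: "Poly_Mapping.lookup m i \<le> mdegree m" for m i
  proof (cases "i \<in> Poly_Mapping.keys m")
    case True
    then show ?thesis unfolding mdegree_def by (intro member_le_sum) auto
  qed (simp add: in_keys_iff)
  have img: "?F ` Mon \<subseteq> {1..n} \<rightarrow>\<^sub>E {..D}"
    by (auto simp: Mon_def intro: order.trans[OF lookup_le])
  have finPiE: "finite ({1..n} \<rightarrow>\<^sub>E {..D})" by (intro finite_PiE) auto
  show "finite Mon"
    using finite_imageD[OF finite_subset[OF img finPiE] inj] .
  have "card Mon = card (?F ` Mon)" by (rule card_image[OF inj, symmetric])
  also have "\<dots> \<le> card ({1..n} \<rightarrow>\<^sub>E {..D})" by (rule card_mono[OF finPiE img])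
  also have "\<dots> = (D + 1) ^ n" by (simp add: card_PiE)
  finally show "card Mon \<le> (D + 1) ^ n" .
qed

lemma indep_mod_0_card_le:
  assumes "indep_mod {0} B" "B \<subseteq> deg_le n D"
  shows "card B \<le> (D + 1) ^ n"
proof -
  let ?Mon = "{m. Poly_Mapping.keys m \<subseteq> {1..n} \<and> mdegree m \<le> D}"
  have "mpoly.independent B"
    using assms(1) by (intro mpoly.independent_if_scalars_zero) (auto simp: indep_mod_def)
  moreover have "B \<subseteq> mpoly.span ((\<lambda>m. Poly_Mapping.single m 1) ` ?Mon)"
  proof
    fix p assume p: "p \<in> B"
    have "Poly_Mapping.single m (Poly_Mapping.lookup p m) \<in> mpoly.span ((\<lambda>m. Poly_Mapping.single m 1) ` ?Mon)"
      if "m \<in> Poly_Mapping.keys p" for m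
    proof -
      have "cscale (Poly_Mapping.lookup p m) (Poly_Mapping.single m 1)
          \<in> mpoly.span ((\<lambda>m. Poly_Mapping.single m 1) ` ?Mon)"
        using that p assms(2) by (intro mpoly.span_scale mpoly.span_base) (auto simp: deg_le_def carrier_poly_ring)
      then show ?thesis by (simp add: mult_single)
    qed
    then show "p \<in> mpoly.span ((\<lambda>m. Poly_Mapping.single m 1) ` ?Mon)"
      by (subst poly_mapping_sum_single) (rule mpoly.span_sum)
  qed
  ultimately have "card B \<le> card ((\<lambda>m. Poly_Mapping.single m (1::'a)) ` ?Mon)"
    using mpoly.independent_span_bound card_monomials_le(1)[of n D] by blast
  also have "\<dots> \<le> card ?Mon" by (rule card_image_le[OF card_monomials_le(1)])
  also have "\<dots> \<le> (D + 1) ^ n" by (rule card_monomials_le(2))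
  finally show ?thesis .
qed

text \<open>If \<open>P \<subset> Q\<close> and \<open>f \<in> Q - P\<close>, then sets independent modulo
  \<open>Q\<close> and modulo \<open>P\<close> combine, which is Pascal's rule for the cardinalities.\<close>

lemma prime_chain_growth:
  fixes P :: "nat \<Rightarrow> 'k::field mpoly set"
  assumes P: "\<And>i. i \<le> k \<Longrightarrow> primeideal (P i) (poly_ring n)"
    and sub: "\<And>i. i < k \<Longrightarrow> P i \<subset> P (Suc i)"
  obtains E where "\<And>m. \<exists>B \<subseteq> deg_le n (E * m). indep_mod (P 0) B \<and> card B = (m + k) choose k"
proof -
  have "\<exists>f D. f \<in> P (Suc i) \<and> f \<notin> P i \<and> f \<in> deg_le n D" if i: "i < k" for i
  proof -
    obtain f where f: "f \<in> P (Suc i)" "f \<notin> P i" using sub[OF i] by blast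
    then have "f \<in> carrier (poly_ring n)"
      using ideal_poly_carrier[OF primeideal_poly_ideal[OF P[of "Suc i"]]] i by auto
    then show ?thesis using f exists_deg_le by blast
  qed
  then obtain f D where f: "\<And>i. i < k \<Longrightarrow> f i \<in> P (Suc i) \<and> f i \<notin> P i \<and> f i \<in> deg_le n (D i)"
    by metis
  \<comment> \<open>One degree bound for all the \<open>f i\<close>: multiplying by any of them
    costs at most \<open>E\<close>, which is what raising \<open>m\<close> by one allows.\<close>
  define E where "E = (\<Sum>i<k. D i)"
  have fE: "f i \<in> deg_le n E" if "i < k" for i
  proof -
    have "D i \<le> E" unfolding E_def using that by (intro member_le_sum) auto
    then show ?thesis using f[OF that] deg_le_mono by blast
  qed
  have one: "\<exists>B \<subseteq> deg_le n (E * m). indep_mod (P i) B \<and> card B = 1" if "i \<le> k" for i m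
    using indep_mod_one[OF P[OF that]]
    by (intro exI[of _ "{1}"]) (auto simp: deg_le_def carrier_poly_ring)
  \<comment> \<open>Here \<open>a\<close> counts the strict inclusions above the prime considered,
    starting from the top of the chain. The borders \<open>a = 0\<close> and \<open>m = 0\<close>
    are served by the set \<open>{1}\<close>.\<close>
  have "\<exists>B \<subseteq> deg_le n (E * m). indep_mod (P (k - a)) B \<and> card B = (m + a) choose a" if "a \<le> k" for a m
    using that
  proof (induction a arbitrary: m)
    case 0
    then show ?case using one[of k m] by simp
  next
    case (Suc a)
    note IHa = Suc.IH
    show ?case
    proof (induction m)
      case 0
      then show ?case using one[of "k - Suc a" 0] by simp
    next
      case (Suc m)
      let ?i = "k - Suc a"
      have i: "?i < k" "Suc ?i = k - a" using \<open>Suc a \<le> k\<close> by auto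
      obtain B where B: "B \<subseteq> deg_le n (E * Suc m)" "indep_mod (P (k - a)) B" "card B = (Suc m + a) choose a"
        using IHa[of "Suc m"] \<open>Suc a \<le> k\<close> by auto
      obtain B' where B': "B' \<subseteq> deg_le n (E * m)" "indep_mod (P ?i) B'" "card B' = (m + Suc a) choose (Suc a)"
        using Suc.IH by auto
      have fi: "f ?i \<in> P (k - a)" "f ?i \<notin> P ?i" using f[OF i(1)] i(2) by auto
      have "P ?i \<subseteq> P (k - a)" using sub[OF i(1)] i(2) by auto
      note un = indep_mod_union[OF P[of ?i] primeideal_poly_ideal[OF P[of "k - a"]] this fi B(2) _ B'(2)]
      have "B \<subseteq> carrier (poly_ring n)" "B' \<subseteq> carrier (poly_ring n)"
        using B(1) B'(1) by (auto simp: deg_le_def)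
      note un = un[OF _ _ this]
      have "(*) (f ?i) ` B' \<subseteq> deg_le n (E * Suc m)"
        using deg_le_mult[OF fE[OF i(1)]] B'(1) by (auto simp: subset_iff)
      then show ?case
        using un B B'(3) i(1)
        by (intro exI[of _ "B \<union> (*) (f ?i) ` B'"]) simp
    qed
  qed
  from this[of k] that[of E] show thesis by simp
qed

lemma domain_poly_ring: "domain (poly_ring n :: 'k::field mpoly ring)"
proof -
  interpret cring "poly_ring n :: 'k mpoly ring" by (rule cring_poly_ring)
  show ?thesis by unfold_locales auto
qed

text \<open>With \<open>n\<close> or more inclusions, adding the zero ideal at the bottom gives
  \<open>n + 1\<close> of them. The resulting growth of order \<open>n + 1\<close> contradicts the
  bound of order \<open>n\<close> for the polynomial ring.\<close>

lemma prime_chain_length_less: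
  fixes P :: "nat \<Rightarrow> 'k::field mpoly set"
  assumes P: "\<And>i. i \<le> k \<Longrightarrow> primeideal (P i) (poly_ring n)"
    and sub: "\<And>i. i < k \<Longrightarrow> P i \<subset> P (Suc i)" and nz: "P 0 \<noteq> {0}"
  shows "k < n"
proof (rule ccontr)
  assume "\<not> k < n"
  define Q where "Q = (\<lambda>i. case i of 0 \<Rightarrow> {0} | Suc j \<Rightarrow> P j)"
  have "primeideal {0} (poly_ring n :: 'k mpoly ring)"
    using domain.zeroprimeideal[OF domain_poly_ring, of n] by simp
  then have 1: "primeideal (Q i) (poly_ring n)" if "i \<le> Suc n" for i
    using P that \<open>\<not> k < n\<close> by (auto simp: Q_def split: nat.split)
  have 2: "Q i \<subset> Q (Suc i)" if "i < Suc n" for i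
  proof (cases i)
    case 0
    then show ?thesis
      using nz ideal_poly_zero[OF primeideal_poly_ideal[OF P[of 0]]] by (auto simp: Q_def)
  next
    case (Suc j)
    then show ?thesis using sub[of j] that \<open>\<not> k < n\<close> by (simp add: Q_def)
  qed
  from prime_chain_growth[of "Suc n" Q n, OF 1 2] obtain E where
    E: "\<And>m. \<exists>B \<subseteq> deg_le n (E * m). indep_mod (Q 0) B \<and> card B = (m + Suc n) choose Suc n" by blast
  have le: "(m + Suc n) choose Suc n \<le> (E * m + 1) ^ n" for m
  proof -
    obtain B where B: "B \<subseteq> deg_le n (E * m)" "indep_mod (Q 0) B" "card B = (m + Suc n) choose Suc n"
      using E by blast
    from B(2) have "indep_mod {0} B" by (simp add: Q_def)
    from indep_mod_0_card_le[OF this B(1)] show ?thesis unfolding B(3) .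
  qed
  \<comment> \<open>Chosen so that the two growth estimates, after cancelling the n-th power of
    \<open>m + Suc n\<close>, read \<open>m + Suc n \<le> m\<close>.\<close>
  define m where "m = Suc n ^ Suc n * (E + 1) ^ n"
  have "(real (m + Suc n) / real (Suc n)) ^ Suc n \<le> real ((m + Suc n) choose Suc n)"
    by (rule binomial_ge_n_over_k_pow_k) simp
  also have "\<dots> \<le> real ((E * m + 1) ^ n)" using le of_nat_mono by blast
  also have "\<dots> \<le> real (((E + 1) * (m + Suc n)) ^ n)"
    by (intro of_nat_mono power_mono) (auto simp: algebra_simps)
  also have "\<dots> = (real (E + 1) * real (m + Suc n)) ^ n" by (simp only: of_nat_mult of_nat_power)
  finally have *: "(real (m + Suc n) / real (Suc n)) ^ Suc n \<le> (real (E + 1) * real (m + Suc n)) ^ n" .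
  have "x \<le> a ^ Suc n * e ^ n" if "(x / a) ^ Suc n \<le> (e * x) ^ n" "x > 0" "a > 0" for x a e :: real
  proof -
    have "x ^ Suc n \<le> a ^ Suc n * (e * x) ^ n"
      using that by (simp only: power_divide pos_divide_le_eq zero_less_power mult.commute)
    then have "x * x ^ n \<le> a ^ Suc n * e ^ n * x ^ n"
      by (simp add: power_mult_distrib mult.assoc)
    then show ?thesis using that by (simp only: mult_le_cancel_right) auto
  qed
  from this[OF *] have "real (m + Suc n) \<le> real (Suc n) ^ Suc n * real (E + 1) ^ n" by simp
  also have "\<dots> = real m" by (simp only: m_def of_nat_mult of_nat_power)
  finally show False by simp
qed

text \<open>Primes of the quotient pull back to primes containing \<open>J\<close>, and strict
  inclusions stay strict. The bottom prime contains \<open>p\<close>, hence is nonzero.\<close>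

lemma krull_dim_quot_less:
  assumes J: "ideal J (poly_ring n)" and p: "p \<in> J" "p \<noteq> 0"
  shows "krull_dim (poly_ring n Quot J) < ereal (real n)"
proof -
  interpret J: ideal J "poly_ring n" by fact
  interpret h: ring_hom_ring "poly_ring n" "poly_ring n Quot J" "(+>\<^bsub>poly_ring n\<^esub>) J"
    by (rule J.rcos_ring_hom_ring)
  have chain: "k < n" if P: "\<And>i. i \<le> k \<Longrightarrow> primeideal (P i) (poly_ring n Quot J)"
      "\<And>i. i < k \<Longrightarrow> P i \<subset> P (Suc i)" for k P
  proof (rule prime_chain_length_less)
    let ?Q = "\<lambda>i. {r \<in> carrier (poly_ring n). J +>\<^bsub>poly_ring n\<^esub> r \<in> P i}"
    show "primeideal (?Q i) (poly_ring n)" if "i \<le> k" for i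
      by (rule h.primeideal_vimage[OF cring_poly_ring P(1)[OF that]])
    show "?Q i \<subset> ?Q (Suc i)" if i: "i < k" for i
    proof -
      obtain X where X: "X \<in> P (Suc i)" "X \<notin> P i" using P(2)[OF i] by auto
      interpret Pi: primeideal "P (Suc i)" "poly_ring n Quot J" using P(1) i by simp
      have "X \<in> carrier (poly_ring n Quot J)" using X(1) Pi.a_subset by auto
      then obtain r where "r \<in> carrier (poly_ring n)" "X = J +>\<^bsub>poly_ring n\<^esub> r"
        by (auto simp: FactRing_def A_RCOSETS_def')
      then show ?thesis using X P(2)[OF i] by auto
    qed
    interpret P0: primeideal "P 0" "poly_ring n Quot J" using P(1) by simp
    have "p \<in> carrier (poly_ring n)" using p J.a_subset by auto
    moreover have "J +>\<^bsub>poly_ring n\<^esub> p = \<zero>\<^bsub>poly_ring n Quot J\<^esub>"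
      using p J.a_rcos_const by (simp add: FactRing_def)
    ultimately have "p \<in> ?Q 0" using P0.zero_closed by simp
    then show "?Q 0 \<noteq> {0}" using p(2) by blast
  qed
  \<comment> \<open>A strict bound for every chain would not survive the supremum, so integrality of
    the lengths is used first. The subtraction is in the reals, hence also correct for
    \<open>n = 0\<close>.\<close>
  have "krull_dim (poly_ring n Quot J) \<le> ereal (real n - 1)"
    unfolding krull_dim_def
  proof (rule Sup_least, elim CollectE exE conjE)
    fix x k P
    assume x: "x = ereal (real k)" and P: "\<forall>i\<le>k. primeideal (P i) (poly_ring n Quot J)"
      "\<forall>i<k. P i \<subset> P (Suc i)"
    have "k < n" using P by (intro chain[of k P]) blast+
    then show "x \<le> ereal (real n - 1)" by (simp add: x)
  qed
  also have "\<dots> < ereal (real n)" by simp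
  finally show ?thesis .
qed

section \<open>The kernel of a surjection compatible with a sequence\<close>

lemma ideal_module_simps [simp]:
  "carrier (ideal_module n J) = J" "zero (ideal_module n J) = 0" "add (ideal_module n J) = (+)"
  "Module.smult (ideal_module n J) = (*)" "piece (ideal_module n J) d = J \<inter> homogeneous n d"
  by (simp_all add: ideal_module_def)

lemma module_ideal_module:
  assumes "ideal J (poly_ring n :: 'k::field mpoly ring)"
  shows "module (poly_ring n) (ideal_module n J)"
proof (rule module_criteria)
  show "\<forall>v\<in>carrier (ideal_module n J). \<exists>neg_v\<in>carrier (ideal_module n J).
      v \<oplus>\<^bsub>ideal_module n J\<^esub> neg_v = \<zero>\<^bsub>ideal_module n J\<^esub>"
    using ideal_poly_diff[OF assms ideal_poly_zero[OF assms]] by (auto intro: bexI[of _ "- _"])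
qed (auto simp: cring_poly_ring ideal_poly_zero[OF assms] ideal_poly_add[OF assms] ideal_poly_mult[OF assms]
  algebra_simps)

lemma submodule_ideal_module:
  assumes "ideal J (poly_ring n)" "ideal K (poly_ring n)" "K \<subseteq> J"
  shows "submodule (poly_ring n) K (ideal_module n J)"
  using assms(3) module_ideal_module[OF assms(1)]
  by (intro LinearCombinations.submodule.intro)
    (auto simp: ideal_poly_zero[OF assms(2)] ideal_poly_add[OF assms(2)] ideal_poly_mult[OF assms(2)])

text \<open>A concrete form of \<Theta>U with one coefficient per list entry. \<open>U\<close> is an
  arbitrary set, so that the coefficients can also be confined to a homogeneous piece of an
  ideal.\<close>

definition lincombs :: "'k::field mpoly list \<Rightarrow> 'k mpoly set \<Rightarrow> 'k mpoly set" where
  "lincombs \<Theta> U = {\<Sum>i<length \<Theta>. \<Theta> ! i * u i | u. \<forall>i<length \<Theta>. u i \<in> U}"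

lemma lincombs_snoc: "lincombs (\<Theta> @ [\<theta>]) U = {x + \<theta> * y | x y. x \<in> lincombs \<Theta> U \<and> y \<in> U}"
proof (intro equalityI subsetI)
  fix z assume "z \<in> lincombs (\<Theta> @ [\<theta>]) U"
  then obtain u where "z = (\<Sum>i<Suc (length \<Theta>). (\<Theta> @ [\<theta>]) ! i * u i)" "\<forall>i<Suc (length \<Theta>). u i \<in> U"
    by (auto simp: lincombs_def)
  then have "z = (\<Sum>i<length \<Theta>. \<Theta> ! i * u i) + \<theta> * u (length \<Theta>)" "\<forall>i<length \<Theta>. u i \<in> U" "u (length \<Theta>) \<in> U"
    by (auto simp: nth_append)
  then show "z \<in> {x + \<theta> * y | x y. x \<in> lincombs \<Theta> U \<and> y \<in> U}"
    unfolding lincombs_def by blast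
next
  fix z assume "z \<in> {x + \<theta> * y | x y. x \<in> lincombs \<Theta> U \<and> y \<in> U}"
  then obtain u y where u: "z = (\<Sum>i<length \<Theta>. \<Theta> ! i * u i) + \<theta> * y" "\<forall>i<length \<Theta>. u i \<in> U" "y \<in> U"
    by (auto simp: lincombs_def)
  then have "z = (\<Sum>i<length (\<Theta> @ [\<theta>]). (\<Theta> @ [\<theta>]) ! i * (u(length \<Theta> := y)) i)"
    by (auto simp: nth_append)
  then show "z \<in> lincombs (\<Theta> @ [\<theta>]) U"
    using u(2,3) unfolding lincombs_def
    by (intro CollectI exI[of _ "u(length \<Theta> := y)"]) (simp add: less_Suc_eq)
qed

lemma seq_mult_ideal_module:
  assumes "ideal J (poly_ring n)" "set \<Theta> \<subseteq> carrier (poly_ring n)"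
  shows "seq_mult (poly_ring n) \<Theta> (ideal_module n J) = lincombs \<Theta> J"
  using assms(2)
proof (induction \<Theta> rule: rev_induct)
  case Nil
  then show ?case using module_ideal_module[OF assms(1)] by (simp add: seq_mult_Nil lincombs_def)
next
  case (snoc \<theta> \<Theta>)
  then show ?case
    using seq_mult_snoc[OF module_ideal_module[OF assms(1)], of \<Theta> \<theta>] by (simp add: lincombs_snoc)
qed

lemma ideal_poly_sum:
  "ideal P (poly_ring n) \<Longrightarrow> (\<And>x. x \<in> F \<Longrightarrow> f x \<in> P) \<Longrightarrow> sum f F \<in> P"
  by (induction F rule: infinite_finite_induct) (auto simp: ideal_poly_zero ideal_poly_add)

lemma lincombs_subset:
  assumes "ideal J (poly_ring n)" "set \<Theta> \<subseteq> carrier (poly_ring n)"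
  shows "lincombs \<Theta> J \<subseteq> J"
  using assms(2) unfolding lincombs_def
  by (auto intro!: ideal_poly_sum[OF assms(1)] ideal_poly_mult[OF assms(1)])

lemma lincombs_add:
  assumes "ideal J (poly_ring n)" "x \<in> lincombs \<Theta> J" "y \<in> lincombs \<Theta> J"
  shows "x + y \<in> lincombs \<Theta> J"
proof -
  obtain u v where "x = (\<Sum>i<length \<Theta>. \<Theta> ! i * u i)" "\<forall>i<length \<Theta>. u i \<in> J"
      "y = (\<Sum>i<length \<Theta>. \<Theta> ! i * v i)" "\<forall>i<length \<Theta>. v i \<in> J"
    using assms(2,3) unfolding lincombs_def by auto
  then show ?thesis
    unfolding lincombs_def using ideal_poly_add[OF assms(1)]
    by (intro CollectI exI[of _ "\<lambda>i. u i + v i"]) (simp add: distrib_left sum.distrib)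
qed

text \<open>Surjectivity on the colon quotients in terms of elements. The union over a coset
  collapses to a single class because \<phi> maps the submodule of \<open>B\<close> onto that of
  \<open>A\<close>.\<close>

lemma seq_surjection_colon_lift:
  assumes surj: "seq_surjection R \<Theta> B A \<phi>" and s: "s < length \<Theta>"
    and modB: "module R B" and modA: "module R A" and \<Theta>: "set \<Theta> \<subseteq> carrier R"
    and y: "y \<in> carrier A" "\<Theta> ! s \<odot>\<^bsub>A\<^esub> y \<in> seq_mult R (take s \<Theta>) A"
  obtains c where "c \<in> carrier B" "\<Theta> ! s \<odot>\<^bsub>B\<^esub> c \<in> seq_mult R (take s \<Theta>) B"
    "y \<ominus>\<^bsub>A\<^esub> \<phi> c \<in> seq_mult R (take s \<Theta>) A"
proof -
  let ?S = "seq_mult R (take s \<Theta>) B" and ?T = "seq_mult R (take s \<Theta>) A" and ?\<theta> = "\<Theta> ! s"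
  have \<Theta>s: "set (take s \<Theta>) \<subseteq> carrier R" using \<Theta> set_take_subset by fast
  have hom: "mod_hom R B A \<phi>"
    using surj modB modA by (simp add: seq_surjection_def mod_hom_def mod_hom_axioms_def)
  interpret mod_hom R B A \<phi> by (rule hom)
  have im: "?T = \<phi> ` ?S"
    using seq_mult_image[OF hom _ \<Theta>s] surj by (simp add: seq_surjection_def)
  have subS: "submodule R ?S B" and subT: "submodule R ?T A"
    using submodule_seq_mult \<Theta>s modB modA by auto
  have SB: "?S \<subseteq> carrier B" by (rule submodule.subset[OF subS])
  note eq = coset_eq_iff[OF modA subT]
  have "?T +>\<^bsub>A\<^esub> y \<in> colon_quotient A ?T ?\<theta>"
    using y by (auto simp: colon_quotient_def colon_def)
  then have "?T +>\<^bsub>A\<^esub> y \<in> (\<lambda>X. \<Union>x\<in>X. ?T +>\<^bsub>A\<^esub> \<phi> x) ` colon_quotient B ?S ?\<theta>"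
    using surj s by (simp add: seq_surjection_def Let_def)
  then obtain c where c: "c \<in> colon B ?S ?\<theta>" "?T +>\<^bsub>A\<^esub> y = (\<Union>x\<in>?S +>\<^bsub>B\<^esub> c. ?T +>\<^bsub>A\<^esub> \<phi> x)"
    by (auto simp: colon_quotient_def)
  then have cB: "c \<in> carrier B" by (simp add: colon_def)
  have "\<forall>x\<in>?S +>\<^bsub>B\<^esub> c. ?T +>\<^bsub>A\<^esub> \<phi> x = ?T +>\<^bsub>A\<^esub> \<phi> c"
  proof
    fix x assume "x \<in> ?S +>\<^bsub>B\<^esub> c"
    then obtain z where z: "z \<in> ?S" "x = z \<oplus>\<^bsub>B\<^esub> c" by (auto simp: a_r_coset_def')
    then have zB: "z \<in> carrier B" using SB by auto
    have "\<phi> x \<ominus>\<^bsub>A\<^esub> \<phi> c = \<phi> z"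
      using z zB cB by (simp add: a_minus_def N.M.a_assoc N.M.r_neg)
    then show "?T +>\<^bsub>A\<^esub> \<phi> x = ?T +>\<^bsub>A\<^esub> \<phi> c"
      using z zB cB im by (subst eq) auto
  qed
  moreover have "c \<in> ?S +>\<^bsub>B\<^esub> c"
    using abelian_subgroup.a_rcos_self[OF abelian_subgroup_submodule[OF modB subS] cB] .
  ultimately have "(\<Union>x\<in>?S +>\<^bsub>B\<^esub> c. ?T +>\<^bsub>A\<^esub> \<phi> x) = ?T +>\<^bsub>A\<^esub> \<phi> c"
    by (intro UN_constant_eq)
  then have "y \<ominus>\<^bsub>A\<^esub> \<phi> c \<in> ?T"
    using c(2) eq y(1) cB by simp
  then show thesis
    using that[of c] c(1) by (simp add: colon_def)
qed

text \<open>Proves \<open>K \<inter> \<Theta>\<^sub>s J = \<Theta>\<^sub>s K\<close> by induction on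
  the prefix length. If b + \<theta> c lies in K, then the image of c is in a colon submodule of
  \<open>A\<close>; lifting that membership to J lets c be corrected to an element of K, at the
  price of changing b within the shorter prefix.\<close>

lemma seq_surjection_kernel:
  assumes surj: "seq_surjection (poly_ring n) \<Theta> (ideal_module n J) A \<phi>"
    and J: "ideal J (poly_ring n)" and A: "module (poly_ring n) A"
    and \<Theta>: "set \<Theta> \<subseteq> carrier (poly_ring n)"
    and K: "\<And>x. x \<in> J \<Longrightarrow> \<phi> x = \<zero>\<^bsub>A\<^esub> \<longleftrightarrow> x \<in> K"
    and "s \<le> length \<Theta>" "x \<in> lincombs (take s \<Theta>) J" "x \<in> K"
  shows "x \<in> lincombs (take s \<Theta>) K"
  using assms(6-8)
proof (induction s arbitrary: x)
  case 0
  then show ?case by (simp add: lincombs_def)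
next
  case (Suc s)
  note modB = module_ideal_module[OF J]
  have hom: "mod_hom (poly_ring n) (ideal_module n J) A \<phi>"
    using surj modB A by (simp add: seq_surjection_def mod_hom_def mod_hom_axioms_def)
  interpret mod_hom "poly_ring n" "ideal_module n J" A \<phi> by (rule hom)
  note [simp] = f_add[simplified] f_smult[simplified] f_minus
  have minus: "\<ominus>\<^bsub>ideal_module n J\<^esub> y = - y" if "y \<in> J" for y
    using that ideal_poly_diff[OF J ideal_poly_zero[OF J] that]
    by (intro M.M.minus_equality) auto
  have \<phi>_diff: "\<phi> (y - z) = \<phi> y \<ominus>\<^bsub>A\<^esub> \<phi> z" if "y \<in> J" "z \<in> J" for y z
    using f_minus[of y z] that minus by (simp add: a_minus_def)
  let ?\<theta> = "\<Theta> ! s"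
  have s: "s < length \<Theta>" and tk: "take (Suc s) \<Theta> = take s \<Theta> @ [?\<theta>]"
    using Suc.prems by (auto simp: take_Suc_conv_app_nth)
  have \<theta>C: "?\<theta> \<in> carrier (poly_ring n)" using \<Theta> s by (auto simp: subset_iff)
  have \<Theta>s: "set (take s \<Theta>) \<subseteq> carrier (poly_ring n)" using \<Theta> set_take_subset by fast
  have SJ: "seq_mult (poly_ring n) (take s \<Theta>) (ideal_module n J) = lincombs (take s \<Theta>) J"
    by (rule seq_mult_ideal_module[OF J \<Theta>s])
  have T: "seq_mult (poly_ring n) (take s \<Theta>) A = \<phi> ` lincombs (take s \<Theta>) J"
    using seq_mult_image[OF hom _ \<Theta>s] surj SJ by (simp add: seq_surjection_def)
  note sub = lincombs_subset[OF J \<Theta>s]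
  obtain b c where bc: "x = b + ?\<theta> * c" "b \<in> lincombs (take s \<Theta>) J" "c \<in> J"
    using Suc.prems(2) unfolding tk lincombs_snoc by blast
  have bJ: "b \<in> J" using bc(2) sub by auto
  have "\<zero>\<^bsub>A\<^esub> = \<phi> x"
    using K[of x] Suc.prems(3) bc bJ ideal_poly_add[OF J bJ ideal_poly_mult[OF J \<theta>C bc(3)]] by simp
  also have "\<phi> x = \<phi> b \<oplus>\<^bsub>A\<^esub> ?\<theta> \<odot>\<^bsub>A\<^esub> \<phi> c"
    using bc bJ \<theta>C ideal_poly_mult[OF J \<theta>C bc(3)] by simp
  finally have "\<phi> b \<oplus>\<^bsub>A\<^esub> ?\<theta> \<odot>\<^bsub>A\<^esub> \<phi> c = \<zero>\<^bsub>A\<^esub>" ..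
  then have "?\<theta> \<odot>\<^bsub>A\<^esub> \<phi> c = \<ominus>\<^bsub>A\<^esub> \<phi> b"
    using bc bJ \<theta>C by (intro N.M.minus_equality[symmetric]) (auto simp: N.M.a_comm)
  moreover have "\<ominus>\<^bsub>A\<^esub> \<phi> b \<in> \<phi> ` lincombs (take s \<Theta>) J"
    using abelian_subgroup_submodule[OF A submodule_seq_mult[OF A \<Theta>s]] bc(2)
    unfolding T by (intro additive_subgroup.a_inv_closed abelian_subgroup.axioms(1)) auto
  ultimately have mem: "?\<theta> \<odot>\<^bsub>A\<^esub> \<phi> c \<in> seq_mult (poly_ring n) (take s \<Theta>) A"
    by (simp add: T)
  obtain c' where c': "c' \<in> J" "?\<theta> * c' \<in> lincombs (take s \<Theta>) J"
      "\<phi> c \<ominus>\<^bsub>A\<^esub> \<phi> c' \<in> \<phi> ` lincombs (take s \<Theta>) J"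
    using seq_surjection_colon_lift[OF surj s modB A \<Theta> _ mem] bc(3) unfolding SJ T by auto
  then obtain c'' where c'': "c'' \<in> lincombs (take s \<Theta>) J" "\<phi> c \<ominus>\<^bsub>A\<^esub> \<phi> c' = \<phi> c''" by auto
  have c''J: "c'' \<in> J" using c''(1) sub by auto
  \<comment> \<open>\<open>c'\<close> lifts the class of \<phi> c inside the colon submodule and
    \<open>c''\<close> lifts the remaining error, so \<phi> vanishes on the difference.\<close>
  define \<kappa> where "\<kappa> = c - c' - c''"
  have cc': "c - c' \<in> J" and \<kappa>J: "\<kappa> \<in> J"
    unfolding \<kappa>_def using bc(3) c'(1) c''J ideal_poly_diff[OF J] by auto
  have "\<phi> \<kappa> = \<zero>\<^bsub>A\<^esub>"
    unfolding \<kappa>_def using bc(3) c' c''J cc' c''(2) by (simp add: \<phi>_diff)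
  then have \<kappa>K: "\<kappa> \<in> K" using K \<kappa>J by simp
  \<comment> \<open>The remainder \<open>x - ?\<theta> * \<kappa>\<close>: all three summands belong
    to the shorter prefix, and it lies in \<open>K\<close>, so the induction hypothesis
    applies.\<close>
  define b' where "b' = b + ?\<theta> * c' + ?\<theta> * c''"
  have "?\<theta> * c'' \<in> lincombs (take s \<Theta>) J"
    using submodule.smult_closed[OF submodule_seq_mult[OF modB \<Theta>s] \<theta>C, of c''] c''(1) by (simp add: SJ)
  then have b': "b' \<in> lincombs (take s \<Theta>) J"
    unfolding b'_def using bc(2) c'(2) lincombs_add[OF J] by blast
  have x: "x = b' + ?\<theta> * \<kappa>" by (simp add: bc(1) b'_def \<kappa>_def algebra_simps)
  have "\<phi> b' = \<zero>\<^bsub>A\<^esub>"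
  proof -
    have b'J: "b' \<in> J" using b' sub by auto
    have "\<phi> x = \<phi> b' \<oplus>\<^bsub>A\<^esub> ?\<theta> \<odot>\<^bsub>A\<^esub> \<phi> \<kappa>"
      unfolding x using b'J \<kappa>J \<theta>C ideal_poly_mult[OF J \<theta>C \<kappa>J] by simp
    then show ?thesis
      using \<open>\<phi> \<kappa> = \<zero>\<^bsub>A\<^esub>\<close> \<open>\<zero>\<^bsub>A\<^esub> = \<phi> x\<close>[symmetric] b'J \<theta>C by simp
  qed
  then have "b' \<in> K" using K b' sub by auto
  then have "b' \<in> lincombs (take s \<Theta>) K" using Suc.IH b' s by simp
  then show ?case unfolding tk lincombs_snoc using x \<kappa>K by blast
qed

section \<open>Linear forms with a common zero\<close>

lemma single_eq_single_iff: "c \<noteq> 0 \<Longrightarrow> Poly_Mapping.single i c = Poly_Mapping.single j c \<longleftrightarrow> i = j"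
  by (metis lookup_single_eq lookup_single_not_eq)

lemma single_mdegree_1:
  assumes "mdegree m = 1"
  obtains i where "m = Poly_Mapping.single i 1"
proof -
  have "Poly_Mapping.keys m \<noteq> {}" using assms by (auto simp: mdegree_def)
  then obtain i where i: "i \<in> Poly_Mapping.keys m" by blast
  have "mdegree m = Poly_Mapping.lookup m i + (\<Sum>j\<in>Poly_Mapping.keys m - {i}. Poly_Mapping.lookup m j)"
    unfolding mdegree_def using i by (simp add: sum.remove)
  moreover have "Poly_Mapping.lookup m i > 0" using i by (simp add: in_keys_iff)
  ultimately have li: "Poly_Mapping.lookup m i = 1" and
    0: "(\<Sum>j\<in>Poly_Mapping.keys m - {i}. Poly_Mapping.lookup m j) = 0"
    using assms by linarith+
  have "Poly_Mapping.lookup m j = 0" if "j \<noteq> i" for j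
  proof (cases "j \<in> Poly_Mapping.keys m")
    case True
    have "\<forall>j\<in>Poly_Mapping.keys m - {i}. Poly_Mapping.lookup m j = 0"
      using 0 by (subst (asm) sum_eq_0_iff) auto
    then show ?thesis using True that by blast
  qed (simp add: in_keys_iff)
  then have "m = Poly_Mapping.single i 1"
    using li by (intro poly_mapping_eqI) (auto simp: lookup_single when_def)
  then show thesis by (rule that)
qed

abbreviation pvar :: "nat \<Rightarrow> 'k::field mpoly" where
  "pvar i \<equiv> Poly_Mapping.single (Poly_Mapping.single i 1) 1"

abbreviation lcoeff :: "'k::field mpoly \<Rightarrow> nat \<Rightarrow> 'k" where
  "lcoeff \<theta> i \<equiv> Poly_Mapping.lookup \<theta> (Poly_Mapping.single i 1)"

lemma linear_form_eq:
  assumes "\<theta> \<in> homogeneous n 1"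
  shows "\<theta> = (\<Sum>i\<in>{1..n}. cscale (lcoeff \<theta> i) (pvar i))"
proof (rule poly_mapping_eqI)
  fix m
  show "Poly_Mapping.lookup \<theta> m = Poly_Mapping.lookup (\<Sum>i\<in>{1..n}. cscale (lcoeff \<theta> i) (pvar i)) m"
  proof (cases "\<exists>i\<in>{1..n}. m = Poly_Mapping.single i 1")
    case True
    then obtain j where j: "j \<in> {1..n}" "m = Poly_Mapping.single j 1" by auto
    have "(\<Sum>i\<in>{1..n}. Poly_Mapping.lookup (cscale (lcoeff \<theta> i) (pvar i)) m)
      = (\<Sum>i\<in>{1..n}. if i = j then lcoeff \<theta> j else 0)"
      by (intro sum.cong) (auto simp: j(2) mult_single lookup_single when_def single_eq_single_iff)
    then show ?thesis using j by (simp add: lookup_sum)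
  next
    case False
    have "m \<notin> Poly_Mapping.keys \<theta>"
    proof
      assume m: "m \<in> Poly_Mapping.keys \<theta>"
      then have "mdegree m = 1" "Poly_Mapping.keys m \<subseteq> {1..n}"
        using assms by (auto simp: homogeneous_def carrier_poly_ring)
      moreover from this(1) obtain i where "m = Poly_Mapping.single i 1" by (rule single_mdegree_1)
      ultimately show False using False by auto
    qed
    moreover have "(\<Sum>i\<in>{1..n}. Poly_Mapping.lookup (cscale (lcoeff \<theta> i) (pvar i)) m) = 0"
      using False by (intro sum.neutral) (auto simp: mult_single lookup_single when_def)
    ultimately show ?thesis by (simp add: lookup_sum in_keys_iff)
  qed
qed

lemma independent_pvars: "mpoly.independent (pvar ` I :: 'k::field mpoly set)"
  unfolding mpoly.independent_explicit_finite_subsets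
proof (intro allI impI ballI)
  fix S :: "'k mpoly set" and u :: "'k mpoly \<Rightarrow> 'k" and v
  assume S: "S \<subseteq> pvar ` I" "finite S" and 0: "(\<Sum>v\<in>S. cscale (u v) v) = 0" and v: "v \<in> S"
  obtain i where i: "v = pvar i" using S v by auto
  have "0 = Poly_Mapping.lookup (\<Sum>v\<in>S. cscale (u v) v) (Poly_Mapping.single i 1)" by (simp add: 0)
  also have "\<dots> = (\<Sum>w\<in>S. if w = v then u v else 0)"
    unfolding lookup_sum
  proof (rule sum.cong)
    fix w assume "w \<in> S"
    then obtain j where j: "w = pvar j" using S by auto
    have "pvar j = (pvar i :: 'k mpoly) \<longleftrightarrow> j = i"
      by (simp add: single_eq_single_iff)
    then show "Poly_Mapping.lookup (cscale (u w) w) (Poly_Mapping.single i 1) = (if w = v then u v else 0)"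
      by (auto simp: i j mult_single lookup_single when_def)
  qed simp
  also have "\<dots> = u v" using S v by simp
  finally show "u v = 0" by simp
qed

text \<open>Fewer than \<open>n\<close> forms cannot span all the variables. A linear functional
  that vanishes on \<Theta> and is 1 on a variable outside the span yields the point: its
  coordinates are the values on the variables.\<close>

lemma exists_common_zero:
  fixes \<Theta> :: "'k::field mpoly list"
  assumes "set \<Theta> \<subseteq> homogeneous n 1" "length \<Theta> < n"
  obtains p :: "nat \<Rightarrow> 'k" and j where "j \<in> {1..n}" "p j \<noteq> 0"
    "\<And>\<theta>. \<theta> \<in> set \<Theta> \<Longrightarrow> (\<Sum>i\<in>{1..n}. lcoeff \<theta> i * p i) = 0"
proof -
  interpret field_vs: vector_space "(*) :: 'k \<Rightarrow> 'k \<Rightarrow> 'k"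
    by unfold_locales (auto simp: algebra_simps)
  interpret vp: vector_space_pair "cscale :: 'k \<Rightarrow> 'k mpoly \<Rightarrow> 'k mpoly" "(*) :: 'k \<Rightarrow> 'k \<Rightarrow> 'k" ..
  have "\<not> pvar ` {1..n} \<subseteq> mpoly.span (set \<Theta>)"
  proof
    assume "pvar ` {1..n} \<subseteq> mpoly.span (set \<Theta>)"
    then have "card (pvar ` {1..n} :: 'k mpoly set) \<le> card (set \<Theta>)"
      using mpoly.independent_span_bound[OF _ independent_pvars] by auto
    moreover have "inj (pvar :: nat \<Rightarrow> 'k mpoly)"
      by (simp add: inj_def single_eq_single_iff)
    then have "card (pvar ` {1..n} :: 'k mpoly set) = n"
      by (subst card_image) (auto intro: inj_on_subset)
    ultimately show False using assms(2) card_length[of \<Theta>] by linarith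
  qed
  then obtain j where j: "j \<in> {1..n}" "(pvar j :: 'k mpoly) \<notin> mpoly.span (set \<Theta>)" by blast
  \<comment> \<open>\<open>construct\<close> prescribes values on independent sets, so \<Theta> is
    replaced by a basis of its span.\<close>
  obtain B where B: "B \<subseteq> set \<Theta>" "mpoly.independent B" "set \<Theta> \<subseteq> mpoly.span B"
    using mpoly.maximal_independent_subset by blast
  have "pvar j \<notin> mpoly.span B" using j(2) mpoly.span_mono[OF B(1)] by auto
  then have ind: "mpoly.independent (insert (pvar j) B)" "pvar j \<notin> B"
    using B(2) mpoly.span_base by (auto simp: mpoly.independent_insert)
  define L where "L = vp.construct (insert (pvar j) B) (\<lambda>x. if x = pvar j then 1 else 0)"
  have L: "Vector_Spaces.linear cscale (*) L" unfolding L_def by (rule vp.linear_construct[OF ind(1)])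
  interpret L: Vector_Spaces.linear cscale "(*)" L by (rule L)
  have Lj: "L (pvar j) = 1" unfolding L_def by (subst vp.construct_basis[OF ind(1)]) auto
  have LB: "L x = 0" if "x \<in> B" for x
    unfolding L_def using that ind(2) by (subst vp.construct_basis[OF ind(1)]) auto
  have "(\<Sum>i\<in>{1..n}. lcoeff \<theta> i * L (pvar i)) = 0" if "\<theta> \<in> set \<Theta>" for \<theta>
  proof -
    have "L \<theta> = 0" using L.eq_0_on_span[OF LB] B(3) that by blast
    moreover have "L \<theta> = (\<Sum>i\<in>{1..n}. lcoeff \<theta> i * L (pvar i))"
      using assms(1) that by (subst linear_form_eq) (auto simp: L.sum L.scale)
    ultimately show ?thesis by simp
  qed
  then show thesis using that[of j "\<lambda>i. L (pvar i)"] j(1) Lj by simp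
qed

text \<open>Substituting \<open>x\<^sub>i = 1 + p\<^sub>i t\<close> turns the linear forms vanishing at \<open>p\<close> into constants.\<close>

definition subst_monom :: "(nat \<Rightarrow> 'k::field) \<Rightarrow> (nat \<Rightarrow>\<^sub>0 nat) \<Rightarrow> 'k poly" where
  "subst_monom p m = (\<Prod>i\<in>Poly_Mapping.keys m. [:1, p i:] ^ Poly_Mapping.lookup m i)"

text \<open>The base point of the line has all coordinates 1, so no variable is sent to zero, even
  where \<open>p i = 0\<close>; hence monomials have nonzero images.\<close>

definition subst_line :: "(nat \<Rightarrow> 'k::field) \<Rightarrow> 'k mpoly \<Rightarrow> 'k poly" where
  "subst_line p f = (\<Sum>m\<in>Poly_Mapping.keys f. [:Poly_Mapping.lookup f m:] * subst_monom p m)"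

lemma subst_monom_add: "subst_monom p (a + b) = subst_monom p a * subst_monom p b"
proof -
  have superset: "subst_monom p m
      = (\<Prod>i\<in>Poly_Mapping.keys a \<union> Poly_Mapping.keys b. [:1, p i:] ^ Poly_Mapping.lookup m i)"
    if "Poly_Mapping.keys m \<subseteq> Poly_Mapping.keys a \<union> Poly_Mapping.keys b" for m
    unfolding subst_monom_def using that by (intro prod.mono_neutral_left) (auto simp: in_keys_iff)
  show ?thesis
    by (simp add: superset keys_nat_add lookup_add power_add prod.distrib)
qed

lemma subst_monom_single: "subst_monom p (Poly_Mapping.single i c) = [:1, p i:] ^ c"
  by (simp add: subst_monom_def)

lemma degree_subst_monom_le: "degree (subst_monom p m) \<le> mdegree m"
proof -
  have "degree (subst_monom p m) \<le> (\<Sum>i\<in>Poly_Mapping.keys m. degree ([:1, p i:] ^ Poly_Mapping.lookup m i))"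
    unfolding subst_monom_def by (rule order.trans[OF degree_prod_sum_le]) simp_all
  also have "\<dots> \<le> mdegree m"
    unfolding mdegree_def
  proof (rule sum_mono)
    fix i
    have "degree ([:1, p i:] ^ Poly_Mapping.lookup m i) \<le> degree [:1, p i:] * Poly_Mapping.lookup m i"
      by (rule degree_power_le)
    also have "\<dots> \<le> 1 * Poly_Mapping.lookup m i" by (intro mult_right_mono) auto
    finally show "degree ([:1, p i:] ^ Poly_Mapping.lookup m i) \<le> Poly_Mapping.lookup m i" by simp
  qed
  finally show ?thesis .
qed

lemma subst_line_0 [simp]: "subst_line p 0 = 0"
  by (simp add: subst_line_def)

lemma subst_line_add: "subst_line p (f + g) = subst_line p f + subst_line p g"
proof -
  have superset: "subst_line p h
      = (\<Sum>m\<in>Poly_Mapping.keys f \<union> Poly_Mapping.keys g. [:Poly_Mapping.lookup h m:] * subst_monom p m)"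
    if "Poly_Mapping.keys h \<subseteq> Poly_Mapping.keys f \<union> Poly_Mapping.keys g" for h
    unfolding subst_line_def using that by (intro sum.mono_neutral_left) (auto simp: in_keys_iff)
  have "[:Poly_Mapping.lookup (f + g) m:] = [:Poly_Mapping.lookup f m:] + [:Poly_Mapping.lookup g m:]" for m
    by (simp add: lookup_add)
  then show ?thesis
    by (simp only: superset keys_add Un_upper1 Un_upper2 distrib_right sum.distrib)
qed

lemma subst_line_sum: "subst_line p (sum h F) = (\<Sum>x\<in>F. subst_line p (h x))"
  by (induction F rule: infinite_finite_induct) (auto simp: subst_line_add)

lemma subst_line_single: "subst_line p (Poly_Mapping.single m c) = [:c:] * subst_monom p m"
  by (simp add: subst_line_def)

lemma subst_line_mult: "subst_line p (f * g) = subst_line p f * subst_line p g"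
proof -
  have "f * g = (\<Sum>a\<in>Poly_Mapping.keys f. \<Sum>b\<in>Poly_Mapping.keys g.
      Poly_Mapping.single (a + b) (Poly_Mapping.lookup f a * Poly_Mapping.lookup g b))"
    by (subst poly_mapping_sum_single[of f], subst poly_mapping_sum_single[of g])
      (simp add: sum_product mult_single)
  then have "subst_line p (f * g) = (\<Sum>a\<in>Poly_Mapping.keys f. \<Sum>b\<in>Poly_Mapping.keys g.
      ([:Poly_Mapping.lookup f a:] * subst_monom p a) * ([:Poly_Mapping.lookup g b:] * subst_monom p b))"
    by (simp add: subst_line_sum subst_line_single subst_monom_add algebra_simps)
  then show ?thesis by (simp only: subst_line_def sum_product)
qed

lemma degree_subst_line_le:
  assumes "f \<in> homogeneous n d" shows "degree (subst_line p f) \<le> d"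
  unfolding subst_line_def
proof (rule degree_sum_le)
  fix m assume "m \<in> Poly_Mapping.keys f"
  then have "mdegree m = d" using assms by (auto simp: homogeneous_def)
  have "degree ([:Poly_Mapping.lookup f m:] * subst_monom p m) \<le> degree (subst_monom p m)"
    using degree_mult_le[of "[:Poly_Mapping.lookup f m:]" "subst_monom p m"] by simp
  then show "degree ([:Poly_Mapping.lookup f m:] * subst_monom p m) \<le> d"
    using degree_subst_monom_le[of p m] \<open>mdegree m = d\<close> by simp
qed simp

text \<open>The coefficient of t is the value of \<theta> at \<open>p\<close>, which vanishes; the
  constant left over is the value at (1, ..., 1).\<close>

lemma subst_line_linear_form:
  assumes "\<theta> \<in> homogeneous n 1" "(\<Sum>i\<in>{1..n}. lcoeff \<theta> i * p i) = 0"
  shows "\<exists>c. subst_line p \<theta> = [:c:]"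
proof -
  have "subst_line p \<theta> = (\<Sum>i\<in>{1..n}. [:lcoeff \<theta> i:] * [:1, p i:])"
    by (subst linear_form_eq[OF assms(1)])
      (simp add: subst_line_sum mult_single subst_line_single subst_monom_single del: mult_pCons_left)
  also have "\<dots> = (\<Sum>i\<in>{1..n}. [:lcoeff \<theta> i, lcoeff \<theta> i * p i:])" by (simp add: mult.commute)
  also have "\<dots> = [:\<Sum>i\<in>{1..n}. lcoeff \<theta> i, \<Sum>i\<in>{1..n}. lcoeff \<theta> i * p i:]"
    by (induction rule: infinite_finite_induct[of _ "{1..n}"]) auto
  finally show ?thesis using assms(2) by auto
qed

section \<open>Homogeneous components\<close>

definition hcomp :: "nat \<Rightarrow> 'k::field mpoly \<Rightarrow> 'k mpoly" where
  "hcomp d f = Poly_Mapping.mapp (\<lambda>m c. c when mdegree m = d) f"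

lemma lookup_hcomp: "Poly_Mapping.lookup (hcomp d f) m = (Poly_Mapping.lookup f m when mdegree m = d)"
  by (auto simp: hcomp_def lookup_mapp when_def in_keys_iff)

lemma keys_hcomp: "Poly_Mapping.keys (hcomp d f) = {m \<in> Poly_Mapping.keys f. mdegree m = d}"
  by (auto simp: in_keys_iff lookup_hcomp)

lemma hcomp_add: "hcomp d (f + g) = hcomp d f + hcomp d g"
  by (rule poly_mapping_eqI) (simp add: lookup_hcomp lookup_add when_def)

lemma hcomp_0 [simp]: "hcomp d 0 = 0"
  by (rule poly_mapping_eqI) (simp add: lookup_hcomp)

lemma hcomp_sum: "hcomp d (sum h F) = (\<Sum>x\<in>F. hcomp d (h x))"
  by (induction F rule: infinite_finite_induct) (auto simp: hcomp_add)

lemma hcomp_homogeneous: "f \<in> homogeneous n e \<Longrightarrow> hcomp d f = (if e = d then f else 0)"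
  by (rule poly_mapping_eqI) (auto simp: lookup_hcomp homogeneous_def when_def in_keys_iff)

lemma hcomp_in_homogeneous: "f \<in> carrier (poly_ring n) \<Longrightarrow> hcomp d f \<in> homogeneous n d"
  by (auto simp: homogeneous_def carrier_poly_ring keys_hcomp)

lemma hcomp_supp_ideal: "f \<in> supp_ideal A \<Longrightarrow> hcomp d f \<in> supp_ideal A"
  by (auto simp: supp_ideal_def keys_hcomp)

lemma homogeneous_mult:
  assumes "f \<in> homogeneous n d" "g \<in> homogeneous n e" shows "f * g \<in> homogeneous n (d + e)"
proof -
  have "mdegree m = d + e" if "m \<in> Poly_Mapping.keys (f * g)" for m
    using that keys_mult[of f g] assms by (auto simp: homogeneous_def mdegree_add)
  then show ?thesis
    using assms poly_ring_mult_closed[of f n g] by (auto simp: homogeneous_def)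
qed

lemma hcomp_linear_mult:
  assumes \<theta>: "\<theta> \<in> homogeneous n 1" and f: "f \<in> carrier (poly_ring n)"
  shows "hcomp (Suc d) (\<theta> * f) = \<theta> * hcomp d f" and "hcomp 0 (\<theta> * f) = 0"
proof -
  let ?s = "\<lambda>m. Poly_Mapping.single m (Poly_Mapping.lookup f m)"
  have s: "?s m \<in> homogeneous n (mdegree m)" if "m \<in> Poly_Mapping.keys f" for m
    using that f by (auto simp: homogeneous_def carrier_poly_ring)
  have eq: "\<theta> * f = (\<Sum>m\<in>Poly_Mapping.keys f. \<theta> * ?s m)"
    by (subst poly_mapping_sum_single[of f]) (simp add: sum_distrib_left)
  have h: "hcomp e (\<theta> * ?s m) = (if Suc (mdegree m) = e then \<theta> * ?s m else 0)"
    if "m \<in> Poly_Mapping.keys f" for m e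
    using hcomp_homogeneous[OF homogeneous_mult[OF \<theta> s[OF that]]] by simp
  show "hcomp 0 (\<theta> * f) = 0"
    unfolding eq hcomp_sum using h by (intro sum.neutral) simp
  have hf: "hcomp d f = (\<Sum>m\<in>Poly_Mapping.keys f. if mdegree m = d then ?s m else 0)"
    by (subst poly_mapping_sum_single[of f], subst hcomp_sum)
      (intro sum.cong refl hcomp_homogeneous[OF s])
  show "hcomp (Suc d) (\<theta> * f) = \<theta> * hcomp d f"
    unfolding eq hcomp_sum hf sum_distrib_left using h by (intro sum.cong) auto
qed

text \<open>Linear forms raise degrees by exactly one, so a component of the sum only involves the
  coefficients one degree lower; these stay in the ideal because it is monomial.\<close>

lemma hcomp_lincombs:
  assumes "set \<Theta> \<subseteq> homogeneous n 1" "upclosed n A" "f \<in> lincombs \<Theta> (supp_ideal A)"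
  shows "hcomp 0 f = 0" and "hcomp (Suc d) f \<in> lincombs \<Theta> (supp_ideal A \<inter> homogeneous n d)"
proof -
  obtain u where u: "f = (\<Sum>i<length \<Theta>. \<Theta> ! i * u i)" "\<And>i. i < length \<Theta> \<Longrightarrow> u i \<in> supp_ideal A"
    using assms(3) by (auto simp: lincombs_def)
  have \<Theta>: "\<Theta> ! i \<in> homogeneous n 1" if "i < length \<Theta>" for i
    using assms(1) that by auto
  have uC: "u i \<in> carrier (poly_ring n)" if "i < length \<Theta>" for i
    using u(2)[OF that] supp_ideal_subset_carrier[OF assms(2)] by auto
  show "hcomp 0 f = 0"
    unfolding u(1) hcomp_sum by (intro sum.neutral) (simp add: hcomp_linear_mult[OF \<Theta> uC])
  have "hcomp (Suc d) f = (\<Sum>i<length \<Theta>. \<Theta> ! i * hcomp d (u i))"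
    unfolding u(1) hcomp_sum by (intro sum.cong) (simp_all add: hcomp_linear_mult[OF \<Theta> uC])
  then show "hcomp (Suc d) f \<in> lincombs \<Theta> (supp_ideal A \<inter> homogeneous n d)"
    unfolding lincombs_def using u(2) uC
    by (intro CollectI exI[of _ "\<lambda>i. hcomp d (u i)"]) (simp add: hcomp_supp_ideal hcomp_in_homogeneous)
qed

text \<open>Along the line \<open>x\<^sub>i = 1 + p\<^sub>i t\<close> all elements \<open>x\<^sub>j\<^sup>m g\<close> with \<open>g\<close> homogeneous of degree \<open>d + 1\<close>
  in the ideal have degree at most \<open>d\<close> in \<open>t\<close>, because every step trades a variable for a linear form in \<open>\<Theta>\<close>,
  that is, for a constant.\<close>

lemma no_generators_up_to_degree:
  fixes \<Theta> :: "'k::field mpoly list"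
  assumes A: "upclosed n A" and \<Theta>: "set \<Theta> \<subseteq> homogeneous n 1" "length \<Theta> < n"
    and sub: "supp_ideal A \<inter> homogeneous n k \<subseteq> lincombs \<Theta> (supp_ideal A)"
    and \<tau>: "\<tau> \<in> A"
  shows "k < card \<tau>"
proof (rule ccontr)
  assume neg: "\<not> k < card \<tau>"
  obtain p :: "nat \<Rightarrow> 'k" and j where j: "j \<in> {1..n}" "p j \<noteq> 0"
    and p: "\<And>\<theta>. \<theta> \<in> set \<Theta> \<Longrightarrow> (\<Sum>i\<in>{1..n}. lcoeff \<theta> i * p i) = 0"
    using exists_common_zero[OF \<Theta>] by blast
  have \<tau>n: "\<tau> \<subseteq> {1..n}" "finite \<tau>" using \<tau> A finite_subset[of \<tau> "{1..n}"] by (auto simp: upclosed_def)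
  \<comment> \<open>Pads the generator on \<tau> to degree exactly \<open>k\<close>, the only degree
    about which \<open>sub\<close> speaks. Up-closure keeps the padded monomial in the
    ideal.\<close>
  define g :: "'k mpoly" where "g = Poly_Mapping.single ((\<Sum>i\<in>\<tau>. Poly_Mapping.single i 1) + Poly_Mapping.single j (k - card \<tau>)) 1"
  have keys_g: "Poly_Mapping.keys ((\<Sum>i\<in>\<tau>. Poly_Mapping.single i 1) + Poly_Mapping.single j (k - card \<tau>))
      = \<tau> \<union> (if k = card \<tau> then {} else {j})"
    using neg by (simp add: keys_nat_add keys_sum_single \<tau>n del: One_nat_def)
  have "g \<in> supp_ideal A"
    unfolding supp_ideal_def g_def using keys_g A \<tau> \<tau>n j(1)
    by (auto simp: upclosed_def simp del: One_nat_def)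
  moreover have "g \<in> homogeneous n k"
    unfolding homogeneous_def carrier_poly_ring g_def using keys_g \<tau>n j(1) neg
    by (auto simp: mdegree_add mdegree_sum_single simp del: One_nat_def)
  ultimately have g: "g \<in> supp_ideal A \<inter> homogeneous n k" by simp
  have "g \<noteq> 0" unfolding g_def by (metis lookup_single_eq lookup_zero one_neq_zero)
  have gl: "hcomp k g = g" using hcomp_homogeneous[of g n k k] g by simp
  have "k \<noteq> 0"
  proof
    assume "k = 0"
    then show False
      using hcomp_lincombs(1)[OF \<Theta>(1) A subsetD[OF sub g]] gl \<open>g \<noteq> 0\<close> by simp
  qed
  then obtain d where d: "k = Suc d" by (cases k) auto
  have xj: "pvar j \<in> homogeneous n 1" "pvar j \<in> carrier (poly_ring n)"
    using j(1) by (auto simp: homogeneous_def carrier_poly_ring simp del: One_nat_def)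
  \<comment> \<open>One exchange: \<open>f\<close> becomes a combination of \<Theta> with
    coefficients of degree \<open>d\<close>, and each form contributes only a constant along the
    line, so any bound for these coefficients times \<open>q\<close> passes to
    \<open>f\<close>.\<close>
  have step: "degree (subst_line p (q * f)) \<le> d"
    if f: "f \<in> supp_ideal A \<inter> homogeneous n k"
      and q: "\<And>u. u \<in> supp_ideal A \<inter> homogeneous n d \<Longrightarrow> degree (subst_line p (q * u)) \<le> d" for f q
  proof -
    have "hcomp k f = f" using hcomp_homogeneous[of f n k k] f by simp
    then have "f \<in> lincombs \<Theta> (supp_ideal A \<inter> homogeneous n d)"
      using hcomp_lincombs(2)[OF \<Theta>(1) A subsetD[OF sub f], of d] by (simp add: d)
    then obtain u where u: "f = (\<Sum>i<length \<Theta>. \<Theta> ! i * u i)"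
        "\<forall>i<length \<Theta>. u i \<in> supp_ideal A \<inter> homogeneous n d"
      by (auto simp: lincombs_def)
    have "q * f = (\<Sum>i<length \<Theta>. \<Theta> ! i * (q * u i))"
      unfolding u(1) by (simp add: sum_distrib_left mult.left_commute)
    also have "degree (subst_line p \<dots>) \<le> d"
      unfolding subst_line_sum
    proof (rule degree_sum_le)
      fix i assume "i \<in> {..<length \<Theta>}"
      then have i: "\<Theta> ! i \<in> set \<Theta>" "degree (subst_line p (q * u i)) \<le> d" using u(2) q by auto
      obtain c where "subst_line p (\<Theta> ! i) = [:c:]"
        using subst_line_linear_form[OF _ p[OF i(1)]] i(1) \<Theta>(1) by auto
      then have "degree (subst_line p (\<Theta> ! i * (q * u i))) \<le> degree (subst_line p (q * u i))"
        using degree_mult_le[of "[:c:]" "subst_line p (q * u i)"]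
        by (subst subst_line_mult) simp
      then show "degree (subst_line p (\<Theta> ! i * (q * u i))) \<le> d"
        using i(2) by linarith
    qed simp
    finally show ?thesis .
  qed
  have le: "degree (subst_line p (pvar j ^ m * f)) \<le> d" if "f \<in> supp_ideal A \<inter> homogeneous n k" for f m
    using that
  proof (induction m arbitrary: f)
    case (0 f)
    show ?case
      by (rule step[OF 0]) (auto intro: degree_subst_line_le)
  next
    case (Suc m f)
    show ?case
    proof (rule step[OF Suc.prems])
      fix u :: "'k mpoly"
      assume u: "u \<in> supp_ideal A \<inter> homogeneous n d"
      \<comment> \<open>The coefficient \<open>u\<close> has degree \<open>d\<close>, one too low;
        one of the spare factors \<open>pvar j\<close> restores degree \<open>k\<close>, where the
        induction hypothesis applies.\<close>
      then have "pvar j * u \<in> supp_ideal A \<inter> homogeneous n k"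
        using supp_ideal_mult[OF A xj(2)] homogeneous_mult[OF xj(1)] by (auto simp: d)
      from Suc.IH[OF this] show "degree (subst_line p (pvar j ^ Suc m * u)) \<le> d"
        by (simp add: mult_ac)
    qed
  qed
  have pw: "subst_line p (pvar j ^ m) = [:1, p j:] ^ m" for m
  proof (induction m)
    case 0
    show ?case by (simp add: subst_line_def subst_monom_def)
  next
    case (Suc m)
    then show ?case
      unfolding power_Suc subst_line_mult by (simp add: subst_line_single subst_monom_single del: mult_pCons_left)
  qed
  have nz: "subst_line p g \<noteq> 0"
    by (auto simp: g_def subst_line_single subst_monom_def)
  \<comment> \<open>The exponent \<open>k\<close> is enough: as \<open>p j\<close> is nonzero, the
    power alone has degree \<open>k\<close>, above the bound \<open>d = k - 1\<close>.\<close>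
  have "degree (subst_line p (pvar j ^ k * g)) = degree ([:1, p j:] ^ k) + degree (subst_line p g)"
    unfolding subst_line_mult pw using nz by (intro degree_mult_eq) auto
  also have "degree ([:1, p j:] ^ k) = k" using j(2) by (simp add: degree_power_eq)
  finally show False using le[OF g, of k] d by simp
qed

section \<open>The nerve ideal and the face module\<close>

text \<open>Two images of the same module with the same kernel are identified through common
  preimages. This serves both M against N/K and, degree by degree, M against N.\<close>

lemma module_iso_of_equal_kernels:
  assumes "mod_hom R B A1 f" "f ` carrier B = carrier A1"
    and "mod_hom R B A2 g" "g ` carrier B = carrier A2"
    and ker: "\<And>x. x \<in> carrier B \<Longrightarrow> f x = \<zero>\<^bsub>A1\<^esub> \<longleftrightarrow> g x = \<zero>\<^bsub>A2\<^esub>"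
  shows "\<exists>F\<in>module_iso R A1 A2. \<forall>x\<in>carrier B. F (f x) = g x"
proof -
  interpret f: mod_hom R B A1 f by fact
  interpret g: mod_hom R B A2 g by fact
  have eq_iff: "f x = f y \<longleftrightarrow> g x = g y" if "x \<in> carrier B" "y \<in> carrier B" for x y
    using ker[of "x \<ominus>\<^bsub>B\<^esub> y"] that by simp
  define F where "F = (\<lambda>a. g (SOME x. x \<in> carrier B \<and> f x = a))"
  have F: "F (f x) = g x" if "x \<in> carrier B" for x
  proof -
    have "(SOME u. u \<in> carrier B \<and> f u = f x) \<in> carrier B \<and> f (SOME u. u \<in> carrier B \<and> f u = f x) = f x"
      by (rule someI[of _ x]) (use that in simp)
    then show ?thesis unfolding F_def using eq_iff that by blast
  qed
  have F_add: "F (f x \<oplus>\<^bsub>A1\<^esub> f y) = g x \<oplus>\<^bsub>A2\<^esub> g y" if "x \<in> carrier B" "y \<in> carrier B" for x y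
    using F[of "x \<oplus>\<^bsub>B\<^esub> y"] that by simp
  have F_smult: "F (c \<odot>\<^bsub>A1\<^esub> f x) = c \<odot>\<^bsub>A2\<^esub> g x" if "c \<in> carrier R" "x \<in> carrier B" for c x
    using F[of "c \<odot>\<^bsub>B\<^esub> x"] that by simp
  have "F \<in> module_hom R A1 A2"
    unfolding module_hom_def assms(2)[symmetric] by (auto simp: F F_add F_smult)
  moreover have "inj_on F (carrier A1)"
    unfolding assms(2)[symmetric] by (rule inj_onI) (auto simp: F eq_iff)
  moreover have "F ` carrier A1 = carrier A2"
    unfolding assms(2,4)[symmetric] image_image by (intro image_cong refl F)
  ultimately have "F \<in> module_iso R A1 A2"
    by (simp add: module_iso_def bij_betw_def)
  then show ?thesis using F by blast
qed

lemma graded_isomorphic_of_equal_kernels: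
  assumes f: "graded_surj R B A1 f" and g: "graded_surj R B A2 g"
    and pieces: "\<And>d. piece B d \<subseteq> carrier B"
    and ker: "\<And>x. x \<in> carrier B \<Longrightarrow> f x = \<zero>\<^bsub>A1\<^esub> \<longleftrightarrow> g x = \<zero>\<^bsub>A2\<^esub>"
  shows "graded_isomorphic R A1 A2"
proof -
  have im: "f ` carrier B = carrier A1" "g ` carrier B = carrier A2"
    and p: "\<And>d. piece A1 d = f ` piece B d" "\<And>d. piece A2 d = g ` piece B d"
    using f g by (auto simp: graded_surj_def)
  have "\<exists>F\<in>module_iso R A1 A2. \<forall>x\<in>carrier B. F (f x) = g x"
    by (rule module_iso_of_equal_kernels
        [OF graded_surj_mod_hom[OF f] im(1) graded_surj_mod_hom[OF g] im(2) ker])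
  then obtain F where F: "F \<in> module_iso R A1 A2" "\<forall>x\<in>carrier B. F (f x) = g x" ..
  have "F ` piece A1 d = piece A2 d" for d
    unfolding p image_image using pieces[of d] F(2) by (intro image_cong refl) auto
  then show ?thesis
    using F(1) by (auto simp: graded_isomorphic_def)
qed

lemma ideal_annihilator:
  assumes "module R A"
  shows "ideal (annihilator R A) R"
proof -
  interpret module R A by fact
  show ?thesis
  proof (rule idealI)
    show "ring R" ..
    show "subgroup (annihilator R A) (add_monoid R)"
    proof (rule subgroup.intro)
      show "inv\<^bsub>add_monoid R\<^esub> r \<in> annihilator R A" if "r \<in> annihilator R A" for r
        using that by (auto simp: annihilator_def smult_l_minus simp flip: a_inv_def)
    qed (auto simp: annihilator_def smult_l_distr)
    show "x \<otimes>\<^bsub>R\<^esub> r \<in> annihilator R A" "r \<otimes>\<^bsub>R\<^esub> x \<in> annihilator R A"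
      if "r \<in> annihilator R A" "x \<in> carrier R" for r x
      using that by (auto simp: annihilator_def smult_assoc1)
  qed
qed

lemma coset_ideal_module: "K +>\<^bsub>ideal_module n J\<^esub> x = K +>\<^bsub>poly_ring n\<^esub> x"
  by (simp add: a_r_coset_def r_coset_def)

lemma homogeneous_closed:
  shows "0 \<in> homogeneous n d" and "p \<in> homogeneous n d \<Longrightarrow> q \<in> homogeneous n d \<Longrightarrow> p + q \<in> homogeneous n d"
    and "p \<in> homogeneous n d \<Longrightarrow> cscale c p \<in> homogeneous n d"
proof -
  show "0 \<in> homogeneous n d" by (simp add: homogeneous_def carrier_poly_ring)
  show "p + q \<in> homogeneous n d" if "p \<in> homogeneous n d" "q \<in> homogeneous n d"
    using that keys_add[of p q] by (auto simp: homogeneous_def carrier_poly_ring subset_iff)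
  show "cscale c p \<in> homogeneous n d" if "p \<in> homogeneous n d"
    using that by (auto simp: homogeneous_def carrier_poly_ring in_keys_iff lookup_cscale)
qed

lemma vs_pieces_ideal_module:
  assumes "ideal J (poly_ring n :: 'k::field mpoly ring)"
  shows "vs_pieces (ideal_module n J)"
  unfolding vs_pieces_def
proof (intro allI conjI)
  fix d
  show "piece (ideal_module n J) d \<subseteq> carrier (ideal_module n J)" by simp
  let ?V = "piece_space (ideal_module n J) d"
  have V: "carrier ?V = J \<inter> homogeneous n d" "zero ?V = 0" "add ?V = (+)" "Module.smult ?V = cscale"
    by (simp_all add: piece_space_def)
  show "vectorspace class_ring ?V"
  proof (rule vs_criteria)
    show "field (class_ring :: 'k ring)" by (rule class_field)
    show "\<forall>v\<in>carrier ?V. \<exists>neg_v\<in>carrier ?V. v \<oplus>\<^bsub>?V\<^esub> neg_v = \<zero>\<^bsub>?V\<^esub>"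
    proof
      fix v assume "v \<in> carrier ?V"
      then have "cscale (- 1) v \<in> carrier ?V"
        unfolding V by (intro IntI homogeneous_closed(3) ideal_poly_mult[OF assms const_carrier]) auto
      then show "\<exists>neg_v\<in>carrier ?V. v \<oplus>\<^bsub>?V\<^esub> neg_v = \<zero>\<^bsub>?V\<^esub>"
        by (rule bexI[rotated]) (simp add: V single_uminus)
    qed
  qed (auto simp: V homogeneous_closed ideal_poly_zero[OF assms] ideal_poly_add[OF assms]
      ideal_poly_mult[OF assms const_carrier] mult_single single_add distrib_left distrib_right add.assoc add.commute simp flip: mult.assoc)
qed

text \<open>With a polynomial the ideal contains each of its monomials, so the finitely many
  monomials of the piece span it.\<close>

lemma fin_dim_piece_supp_ideal:
  assumes A: "upclosed n A"
  shows "vectorspace.fin_dim class_ring (piece_space (ideal_module n (supp_ideal A :: 'k::field mpoly set)) d)"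
proof -
  let ?V = "piece_space (ideal_module n (supp_ideal A :: 'k mpoly set)) d"
  interpret V: vectorspace class_ring ?V
  proof -
    have "vs_pieces (ideal_module n (supp_ideal A :: 'k mpoly set))"
      by (rule vs_pieces_ideal_module[OF ideal_supp_ideal[OF A]])
    then show "vectorspace class_ring ?V" by (simp add: vs_pieces_def)
  qed
  have V: "carrier ?V = supp_ideal A \<inter> homogeneous n d" "zero ?V = 0" "add ?V = (+)" "Module.smult ?V = cscale"
    by (simp_all add: piece_space_def)
  define S :: "'k mpoly set" where
    "S = (\<lambda>m. Poly_Mapping.single m 1) ` {m. Poly_Mapping.keys m \<subseteq> {1..n} \<and> mdegree m \<le> d} \<inter> carrier ?V"
  have fin: "finite S" unfolding S_def using card_monomials_le(1)[of n d] by blast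
  have SV: "S \<subseteq> carrier ?V" by (simp add: S_def)
  interpret S: submodule class_ring "V.span S" ?V by (rule V.span_is_submodule[OF SV])
  have "p \<in> V.span S" if p: "p \<in> carrier ?V" for p
  proof -
    have "Poly_Mapping.single m (Poly_Mapping.lookup p m) \<in> V.span S" if m: "m \<in> Poly_Mapping.keys p" for m
    proof -
      have "Poly_Mapping.single m 1 \<in> S"
        using p m unfolding S_def V by (auto simp: homogeneous_def carrier_poly_ring supp_ideal_def)
      then have "Poly_Mapping.single m 1 \<in> V.span S" using V.in_own_span[OF SV] by blast
      then show ?thesis
        using S.smult_closed[of "Poly_Mapping.lookup p m" "Poly_Mapping.single m 1"] by (simp add: V mult_single)
    qed
    then have "(\<Sum>m\<in>F. Poly_Mapping.single m (Poly_Mapping.lookup p m)) \<in> V.span S"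
      if "F \<subseteq> Poly_Mapping.keys p" for F
      using that
    proof (induction F rule: infinite_finite_induct)
      case (insert m F)
      then show ?case using S.m_closed by (simp add: V)
    qed (use S.zero_closed in \<open>simp_all add: V\<close>)
    then show ?thesis by (subst poly_mapping_sum_single) auto
  qed
  then have "V.gen_set S" using V.span_is_subset2[OF SV] by blast
  then show ?thesis using fin SV V.fin_dim_def by blast
qed

text \<open>The monomials are sorted by whether their support is in \<open>X\<close>. The condition
  on keys keeps \<open>y\<close> homogeneous whenever \<open>p\<close> is, so the splitting respects
  degrees.\<close>

lemma supp_ideal_split:
  assumes "p \<in> supp_ideal (X \<union> Y)"
  obtains x y where "p = x + y" "x \<in> supp_ideal X" "y \<in> supp_ideal Y" "Poly_Mapping.keys y \<subseteq> Poly_Mapping.keys p"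
proof -
  let ?x = "Poly_Mapping.mapp (\<lambda>m c. c when Poly_Mapping.keys m \<in> X) p"
  let ?y = "Poly_Mapping.mapp (\<lambda>m c. c when Poly_Mapping.keys m \<notin> X) p"
  have "p = ?x + ?y"
    by (rule poly_mapping_eqI) (auto simp: lookup_add lookup_mapp when_def in_keys_iff)
  moreover have "?x \<in> supp_ideal X" "?y \<in> supp_ideal Y"
    using assms by (auto simp: supp_ideal_def in_keys_iff lookup_mapp when_def split: if_splits)
  ultimately show thesis by (rule that[OF _ _ _ keys_mapp_subset])
qed

section \<open>Degrees of generators and lowest nonzero pieces\<close>

lemma card_keys_le_mdegree: "card (Poly_Mapping.keys m) \<le> mdegree m"
proof -
  have "card (Poly_Mapping.keys m) = (\<Sum>i\<in>Poly_Mapping.keys m. 1)" by simp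
  also have "\<dots> \<le> mdegree m"
    unfolding mdegree_def by (intro sum_mono) (simp add: in_keys_iff Suc_le_eq)
  finally show ?thesis .
qed

lemma sqfree_monomial_props:
  assumes "\<tau> \<in> A" "upclosed n A"
  shows "sqfree_monomial \<tau> \<in> (supp_ideal A :: 'k::field mpoly set)"
    and "sqfree_monomial \<tau> \<in> (homogeneous n (card \<tau>) :: 'k mpoly set)"
    and "sqfree_monomial \<tau> \<noteq> (0 :: 'k mpoly)"
proof -
  have \<tau>: "\<tau> \<subseteq> {1..n}" "finite \<tau>"
    using assms finite_subset[of \<tau> "{1..n}"] by (auto simp: upclosed_def)
  show "sqfree_monomial \<tau> \<in> (supp_ideal A :: 'k mpoly set)"
    "sqfree_monomial \<tau> \<in> (homogeneous n (card \<tau>) :: 'k mpoly set)"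
    using \<tau> assms(1) by (auto simp: sqfree_monomial_def supp_ideal_def homogeneous_def carrier_poly_ring
        keys_sum_single mdegree_sum_single simp del: One_nat_def)
  show "sqfree_monomial \<tau> \<noteq> (0 :: 'k mpoly)"
    unfolding sqfree_monomial_def by (metis lookup_single_eq lookup_zero one_neq_zero)
qed

text \<open>A monomial has degree at least the size of its support, with equality for the squarefree
  one; so the lowest nonzero degree is the least size of a member of \<open>A\<close>.\<close>

lemma supp_ideal_low_degree_iff:
  assumes A: "upclosed n A"
  shows "(\<forall>k\<le>k\<^sub>0. supp_ideal A \<inter> homogeneous n k \<subseteq> {0 :: 'k::field mpoly}) \<longleftrightarrow> (\<forall>\<tau>\<in>A. k\<^sub>0 < card \<tau>)"
proof
  assume L: "\<forall>k\<le>k\<^sub>0. supp_ideal A \<inter> homogeneous n k \<subseteq> {0 :: 'k mpoly}"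
  show "\<forall>\<tau>\<in>A. k\<^sub>0 < card \<tau>"
  proof (rule ballI, rule ccontr)
    fix \<tau> assume "\<tau> \<in> A" "\<not> k\<^sub>0 < card \<tau>"
    then show False using sqfree_monomial_props[OF \<open>\<tau> \<in> A\<close> A, where ?'k = 'k] L by (force simp: not_less)
  qed
next
  assume R: "\<forall>\<tau>\<in>A. k\<^sub>0 < card \<tau>"
  show "\<forall>k\<le>k\<^sub>0. supp_ideal A \<inter> homogeneous n k \<subseteq> {0 :: 'k mpoly}"
  proof (intro allI impI subsetI)
    fix k and p :: "'k mpoly" assume k: "k \<le> k\<^sub>0" and p: "p \<in> supp_ideal A \<inter> homogeneous n k"
    have "m \<notin> Poly_Mapping.keys p" for m
    proof
      assume "m \<in> Poly_Mapping.keys p"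
      then have "k\<^sub>0 < card (Poly_Mapping.keys m)" "mdegree m = k"
        using R p by (auto simp: supp_ideal_def homogeneous_def)
      then show False using card_keys_le_mdegree[of m] k by simp
    qed
    then have "Poly_Mapping.keys p = {}" by blast
    then show "p \<in> {0}" by simp
  qed
qed

lemma generated_in_degrees_above_supp_ideal:
  assumes A: "upclosed n A"
  shows "generated_in_degrees_above n k (supp_ideal A :: 'k::field mpoly set) \<longleftrightarrow> (\<forall>\<tau>\<in>A. k < card \<tau>)"
proof
  assume "generated_in_degrees_above n k (supp_ideal A :: 'k mpoly set)"
  then obtain S :: "'k mpoly set" where S: "S \<subseteq> (\<Union>d\<in>{k<..}. homogeneous n d)"
      "supp_ideal A = genideal (poly_ring n) S"
    by (auto simp: generated_in_degrees_above_def)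
  \<comment> \<open>An ideal containing every set of forms of degree above \<open>k\<close>. Hence
    it contains whatever such a set generates, and testing it on squarefree monomials bounds their
    degrees, whichever generators \<open>S\<close> were given.\<close>
  define T :: "'k mpoly set" where
    "T = {p \<in> carrier (poly_ring n). \<forall>m\<in>Poly_Mapping.keys p. k < mdegree m}"
  interpret cring "poly_ring n :: 'k mpoly ring" by (rule cring_poly_ring)
  have mult: "r * p \<in> T" if "r \<in> carrier (poly_ring n)" "p \<in> T" for r p
  proof -
    have "k < mdegree m" if m: "m \<in> Poly_Mapping.keys (r * p)" for m
    proof -
      obtain a b where "m = a + b" "b \<in> Poly_Mapping.keys p" using m keys_mult[of r p] by auto
      then show ?thesis using \<open>p \<in> T\<close> by (auto simp: T_def mdegree_add)
    qed
    then show ?thesis using that poly_ring_mult_closed by (auto simp: T_def)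
  qed
  have add: "p + p' \<in> T" if "p \<in> T" "p' \<in> T" for p p'
    using that keys_add[of p p'] by (auto simp: T_def carrier_poly_ring subset_iff)
  have "ideal T (poly_ring n)"
  proof (rule idealI)
    show "ring (poly_ring n :: 'k mpoly ring)" ..
    show "subgroup T (add_monoid (poly_ring n))"
    proof (rule subgroup.intro)
      show "inv\<^bsub>add_monoid (poly_ring n)\<^esub> p \<in> T" if "p \<in> T" for p
      proof -
        have "cscale (- 1) p \<in> T" by (rule mult[OF const_carrier that])
        then have "- p \<in> T" by (simp add: single_uminus)
        moreover have "\<ominus>\<^bsub>poly_ring n\<^esub> p = - p"
          using that \<open>- p \<in> T\<close> by (intro minus_equality) (auto simp: T_def)
        ultimately show ?thesis by (simp add: a_inv_def)
      qed
      show "T \<subseteq> carrier (add_monoid (poly_ring n))" by (auto simp: T_def)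
      show "\<one>\<^bsub>add_monoid (poly_ring n)\<^esub> \<in> T" by (simp add: T_def carrier_poly_ring)
    qed (simp add: add)
    show "p \<otimes>\<^bsub>poly_ring n\<^esub> r \<in> T" "r \<otimes>\<^bsub>poly_ring n\<^esub> p \<in> T"
      if "p \<in> T" "r \<in> carrier (poly_ring n)" for p r
      using mult[OF that(2,1)] by (simp_all add: mult.commute)
  qed
  moreover have "S \<subseteq> T" using S(1) by (auto simp: T_def homogeneous_def)
  ultimately have "supp_ideal A \<subseteq> T" unfolding S(2) by (rule genideal_minimal)
  show "\<forall>\<tau>\<in>A. k < card \<tau>"
  proof
    fix \<tau> assume "\<tau> \<in> A"
    note sq = sqfree_monomial_props[OF this A, where ?'k = 'k]
    have "sqfree_monomial \<tau> \<in> T" using sq(1) \<open>supp_ideal A \<subseteq> T\<close> by auto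
    then show "k < card \<tau>"
      using sq(2) by (auto simp: T_def homogeneous_def sqfree_monomial_def)
  qed
next
  assume R: "\<forall>\<tau>\<in>A. k < card \<tau>"
  show "generated_in_degrees_above n k (supp_ideal A :: 'k mpoly set)"
    unfolding generated_in_degrees_above_def
  proof (intro exI conjI)
    show "sqfree_monomial ` A \<subseteq> (\<Union>d\<in>{k<..}. homogeneous n d :: 'k mpoly set)"
    proof
      fix p :: "'k mpoly" assume "p \<in> sqfree_monomial ` A"
      then obtain \<tau> where "\<tau> \<in> A" "p = sqfree_monomial \<tau>" by auto
      then show "p \<in> (\<Union>d\<in>{k<..}. homogeneous n d)"
        using R sqfree_monomial_props(2)[OF \<open>\<tau> \<in> A\<close> A] by auto
    qed
    show "supp_ideal A = genideal (poly_ring n) (sqfree_monomial ` A)"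
      by (rule genideal_sqfree_monomial[OF A, symmetric])
  qed
qed

lemma piece_dim_le_of_kernels:
  assumes f: "graded_surj (poly_ring n) B A1 f" and g: "graded_surj (poly_ring n) B A2 g"
    and B: "vs_pieces B" "vectorspace.fin_dim class_ring (piece_space B d)"
    and ker: "\<And>x. x \<in> piece B d \<Longrightarrow> f x = \<zero>\<^bsub>A1\<^esub> \<Longrightarrow> g x = \<zero>\<^bsub>A2\<^esub>"
  shows "piece_dim A2 d \<le> piece_dim A1 d"
    and "piece_dim A2 d = piece_dim A1 d \<longleftrightarrow> (\<forall>x\<in>piece B d. g x = \<zero>\<^bsub>A2\<^esub> \<longrightarrow> f x = \<zero>\<^bsub>A1\<^esub>)"
proof -
  have ps [simp]: "carrier (piece_space B d) = piece B d" "zero (piece_space A1 d) = zero A1"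
      "zero (piece_space A2 d) = zero A2"
    by (simp_all add: piece_space_def)
  note * = dim_surj_le[OF linear_map_pieces[OF f B(1)] piece_surj[OF f B(1)] B(2)
      linear_map_pieces[OF g B(1)] piece_surj[OF g B(1)]]
  show "piece_dim A2 d \<le> piece_dim A1 d"
    unfolding piece_dim_def by (rule *(1)) (simp add: ker)
  have "vectorspace.dim class_ring (piece_space A2 d) = vectorspace.dim class_ring (piece_space A1 d)
    \<longleftrightarrow> (\<forall>v\<in>carrier (piece_space B d). g v = \<zero>\<^bsub>piece_space A2 d\<^esub> \<longrightarrow> f v = \<zero>\<^bsub>piece_space A1 d\<^esub>)"
    by (rule *(2)) (simp add: ker)
  then show "piece_dim A2 d = piece_dim A1 d \<longleftrightarrow> (\<forall>x\<in>piece B d. g x = \<zero>\<^bsub>A2\<^esub> \<longrightarrow> f x = \<zero>\<^bsub>A1\<^esub>)"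
    by (simp add: piece_dim_def)
qed

text \<open>Condition (ii) asks for some isomorphism of the pieces. In finite dimension any
  isomorphism forces the given surjection \<open>f\<close> to be injective, so the condition becomes
  one about its kernel.\<close>

lemma pieces_isomorphic_iff_kernel:
  assumes f: "graded_surj (poly_ring n) B A f"
    and B: "vs_pieces B" "vectorspace.fin_dim class_ring (piece_space B d)"
  shows "pieces_isomorphic A B d \<longleftrightarrow> (\<forall>x\<in>piece B d. f x = \<zero>\<^bsub>A\<^esub> \<longrightarrow> x = \<zero>\<^bsub>B\<^esub>)"
proof
  interpret f: linear_map class_ring "piece_space B d" "piece_space A d" f
    by (rule linear_map_pieces[OF f B(1)])
  have ps [simp]: "carrier (piece_space B d) = piece B d" "zero (piece_space B d) = zero B"
      "zero (piece_space A d) = zero A"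
    by (simp_all add: piece_space_def)
  have id: "linear_map class_ring (piece_space B d) (piece_space B d) (\<lambda>x. x)"
    by unfold_locales (auto simp: module_hom_def)
  note surj = piece_surj[OF f B(1), of d]
  {
    assume "pieces_isomorphic A B d"
    then obtain h where h: "h \<in> module_hom class_ring (piece_space A d) (piece_space B d)"
        "bij_betw h (carrier (piece_space A d)) (carrier (piece_space B d))"
      by (auto simp: pieces_isomorphic_def module_iso_def)
    interpret h: linear_map class_ring "piece_space A d" "piece_space B d" h
      by unfold_locales (rule h(1))
    \<comment> \<open>\<open>h\<close> need not be related to \<open>f\<close>; only the equality of
      dimensions is taken from it, and comparing \<open>f\<close> with the identity turns this into
      injectivity.\<close>
    have "f.W.dim = f.V.dim"
      using h.dim_eq f.surj_fin_dim[OF B(2) surj] h(2) by (auto simp: bij_betw_def)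
    then have "\<forall>v\<in>carrier (piece_space B d). f v = \<zero>\<^bsub>piece_space A d\<^esub> \<longrightarrow> v = \<zero>\<^bsub>piece_space B d\<^esub>"
      by (subst (asm) dim_surj_le(2)[OF id _ B(2) f.linear_map_axioms surj]) (auto simp: f.f0_is_0[simplified])
    then show "\<forall>x\<in>piece B d. f x = \<zero>\<^bsub>A\<^esub> \<longrightarrow> x = \<zero>\<^bsub>B\<^esub>" by simp
  }
  assume ker: "\<forall>x\<in>piece B d. f x = \<zero>\<^bsub>A\<^esub> \<longrightarrow> x = \<zero>\<^bsub>B\<^esub>"
  have "\<exists>F\<in>module_iso class_ring (piece_space A d) (piece_space B d).
      \<forall>x\<in>carrier (piece_space B d). F (f x) = x"
    using ker f.f0_is_0
    by (intro module_iso_of_equal_kernels[OF f.mod_hom_axioms surj linear_map.axioms(3)[OF id]]) auto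
  then show "pieces_isomorphic A B d" by (auto simp: pieces_isomorphic_def)
qed

lemma lincombs_mono: "U \<subseteq> W \<Longrightarrow> lincombs \<Theta> U \<subseteq> lincombs \<Theta> W"
  unfolding lincombs_def by blast

theorem theorem4p6:
  fixes n :: nat
    and \<Delta> :: "nat set set"
    and \<G> :: "nat set set set"
    and R :: "'k::field mpoly ring"
    and I N :: "'k mpoly set"
    and M :: "('k mpoly, 'k mpoly set) graded_module"
    and NM :: "('k mpoly, 'k mpoly) graded_module"
    and q :: "'k mpoly \<Rightarrow> 'k mpoly set"
  defines "R \<equiv> poly_ring n"
    and "I \<equiv> stanley_reisner_ideal n \<Delta>"
    and "N \<equiv> nerve_ideal n \<G>"
    and "M \<equiv> face_module n \<Delta> (\<Union>\<G>)"
    and "NM \<equiv> ideal_module n N"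
    and "q \<equiv> (\<lambda>f. I +>\<^bsub>R\<^esub> f)"
  assumes "infinite (UNIV :: 'k set)"
    and "simplicial_complex n \<Delta>"
    and "full_arrangement n \<Delta> \<G>"
  shows "graded_isomorphic R M (quotient_module NM (I \<inter> N))
    \<and> (\<forall>\<Theta>. set \<Theta> \<subseteq> homogeneous n 1 \<longrightarrow>
        (\<forall>k. piece_dim (quotient_module M (seq_mult R \<Theta> M)) k
               \<le> piece_dim (quotient_module NM (seq_mult R \<Theta> NM)) k))
    \<and> (\<forall>\<Theta> k\<^sub>0. lsop n M \<Theta> \<and> seq_surjection R \<Theta> NM M q \<longrightarrow>
        (let i = (piece_dim (quotient_module M (seq_mult R \<Theta> M)) k\<^sub>0
                    = piece_dim (quotient_module NM (seq_mult R \<Theta> NM)) k\<^sub>0);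
             ii = (\<forall>k\<le>k\<^sub>0. pieces_isomorphic M NM k);
             iii = generated_in_degrees_above n k\<^sub>0 (I \<inter> N);
             iv = (\<forall>\<tau>. \<tau> \<subseteq> {1..n} \<and> \<tau> \<notin> \<Delta> \<and> int (card \<tau>) - 1 < int k\<^sub>0 \<longrightarrow>
                     (\<exists>\<Gamma>\<in>\<G>. \<tau> \<subseteq> vertex_set \<Gamma>))
         in (i \<longleftrightarrow> ii) \<and> (ii \<longleftrightarrow> iii) \<and> (iii \<longleftrightarrow> iv)))"
proof -
  \<comment> \<open>The supports describing, in this order, I, N, the ideal of the union of the
    arrangement, and K. Conditions (i) to (iv) will each be matched with
    \<open>\<forall>\<tau>\<in>AK. k\<^sub>0 < card \<tau>\<close>.\<close>
  define AI where "AI = {\<tau>. \<tau> \<subseteq> {1..n} \<and> \<tau> \<notin> \<Delta>}"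
  define AN where "AN = {\<tau>. \<tau> \<subseteq> {1..n} \<and> (\<forall>\<Gamma>\<in>\<G>. \<not> \<tau> \<subseteq> vertex_set \<Gamma>)}"
  define AG where "AG = {\<tau>. \<tau> \<subseteq> {1..n} \<and> \<tau> \<notin> \<Union>\<G>}"
  define AK where "AK = AI \<inter> AN"
  have \<Delta>: "\<tau> \<in> \<Delta>" if "\<sigma> \<in> \<Delta>" "\<tau> \<subseteq> \<sigma>" for \<sigma> \<tau>
    using \<open>simplicial_complex n \<Delta>\<close> that by (auto simp: simplicial_complex_def)
  have \<Gamma>: "\<tau> \<in> \<Gamma>" if "\<Gamma> \<in> \<G>" "\<sigma> \<in> \<Gamma>" "\<tau> \<subseteq> \<sigma>" for \<Gamma> \<sigma> \<tau>
    using \<open>full_arrangement n \<Delta> \<G>\<close> that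
    by (auto simp: full_arrangement_def full_subcomplex_def simplicial_complex_def)
  have up: "upclosed n AI" "upclosed n AN" "upclosed n AG"
    using \<Delta> \<Gamma> unfolding upclosed_def AI_def AN_def AG_def by blast+
  then have upK: "upclosed n AK" unfolding AK_def by (intro upclosed_Int)
  have I: "I = supp_ideal AI" and N: "N = supp_ideal AN"
    and IG: "stanley_reisner_ideal n (\<Union>\<G>) = (supp_ideal AG :: 'k mpoly set)"
    unfolding I_def N_def stanley_reisner_ideal_def nerve_ideal_def AI_def[symmetric] AN_def[symmetric]
      AG_def[symmetric]
    by (intro genideal_sqfree_monomial up)+
  have K: "I \<inter> N = supp_ideal AK" by (simp add: I N AK_def supp_ideal_Int)
  have "\<tau> \<in> AI \<union> AN \<longleftrightarrow> \<tau> \<in> AG" for \<tau>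
  proof
    assume "\<tau> \<in> AI \<union> AN"
    moreover have "\<tau> \<subseteq> vertex_set \<Gamma>" if "\<tau> \<in> \<Gamma>" "\<Gamma> \<in> \<G>" for \<Gamma>
      using \<Gamma>[OF that(2,1)] by (auto simp: vertex_set_def)
    moreover have "\<Union>\<G> \<subseteq> \<Delta>"
      using \<open>full_arrangement n \<Delta> \<G>\<close> by (auto simp: full_arrangement_def full_subcomplex_def)
    ultimately show "\<tau> \<in> AG" unfolding AI_def AN_def AG_def by blast
  next
    \<comment> \<open>Fullness enters here: a face of \<Delta> with all its vertices in some
      V(\<Gamma>) would lie in \<Gamma>.\<close>
    assume "\<tau> \<in> AG"
    then show "\<tau> \<in> AI \<union> AN"
      using \<open>full_arrangement n \<Delta> \<G>\<close>
      unfolding full_arrangement_def full_subcomplex_def AI_def AN_def AG_def by blast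
  qed
  then have AG: "AG = AI \<union> AN" by blast
  have idI: "ideal I R" and idN: "ideal N R" and idK: "ideal (I \<inter> N) R" and idG: "ideal (supp_ideal AG :: 'k mpoly set) R"
    unfolding K unfolding I N R_def by (intro ideal_supp_ideal up upK)+
  let ?GM = "ideal_module n (supp_ideal AG :: 'k mpoly set)"
  have NG: "N \<subseteq> supp_ideal AG" and IsG: "I \<subseteq> supp_ideal AG"
    unfolding I N AG by (intro supp_ideal_mono; blast)+
  have modG: "module R ?GM" and modN: "module R NM"
    unfolding NM_def R_def by (intro module_ideal_module idG[unfolded R_def] idN[unfolded R_def])+
  have subI: "submodule R I ?GM" and subK: "submodule R (I \<inter> N) NM"
    unfolding NM_def R_def
    by (intro submodule_ideal_module idG[unfolded R_def] idI[unfolded R_def] IsG idK[unfolded R_def]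
        idN[unfolded R_def] Int_lower2)+
  have q: "q = (\<lambda>f. I +>\<^bsub>?GM\<^esub> f)" by (simp add: q_def R_def coset_ideal_module)
  have M: "M = quotient_module ?GM I" by (simp add: M_def face_module_def IG I_def)
  have gsG: "graded_surj R ?GM M q"
    unfolding M q by (rule graded_surj_quotient[OF modG subI])
  interpret qG: mod_hom R ?GM M q by (rule graded_surj_mod_hom[OF gsG])
  have modM: "module R M" by (rule qG.N.module_axioms)
  have zM: "\<zero>\<^bsub>M\<^esub> = I" by (simp add: M quotient_module_def)
  have q0: "q f = \<zero>\<^bsub>M\<^esub> \<longleftrightarrow> f \<in> I" if "f \<in> supp_ideal AG" for f
    unfolding zM q using coset_eq_self_iff[OF modG subI] that by simp
  \<comment> \<open>Every class in M has a representative in N, and no new monomials appear in it.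
    This makes the map from N onto M surjective in every degree.\<close>
  have q_split: "\<exists>y. q p = q y \<and> y \<in> N \<and> Poly_Mapping.keys y \<subseteq> Poly_Mapping.keys p"
    if p: "p \<in> supp_ideal AG" for p
  proof -
    obtain x y where xy: "p = x + y" "x \<in> I" "y \<in> N" "Poly_Mapping.keys y \<subseteq> Poly_Mapping.keys p"
      using supp_ideal_split[of p AI AN] p unfolding AG I N by metis
    then have "x \<in> supp_ideal AG" "y \<in> supp_ideal AG" using IsG NG by auto
    then have "q p = q y"
      using qG.f_add[of x y] q0[of x] xy qG.f_im[of y] by simp
    then show ?thesis using xy by blast
  qed
  have qN: "q ` N = q ` supp_ideal AG"
    using q_split NG by (auto simp: image_iff) (metis)
  have qNd: "q ` (N \<inter> homogeneous n d) = q ` (supp_ideal AG \<inter> homogeneous n d)" for d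
  proof
    show "q ` (supp_ideal AG \<inter> homogeneous n d) \<subseteq> q ` (N \<inter> homogeneous n d)"
    proof
      fix X assume "X \<in> q ` (supp_ideal AG \<inter> homogeneous n d)"
      then obtain p where p: "p \<in> supp_ideal AG" "p \<in> homogeneous n d" "X = q p" by auto
      then obtain y where y: "q p = q y" "y \<in> N" "Poly_Mapping.keys y \<subseteq> Poly_Mapping.keys p"
        using q_split by blast
      then have "y \<in> homogeneous n d" using p(2) by (auto simp: homogeneous_def carrier_poly_ring subset_iff)
      then show "X \<in> q ` (N \<inter> homogeneous n d)" using p(3) y by auto
    qed
  qed (use NG in blast)
  have gs: "graded_surj R NM M q"
    unfolding graded_surj_def
  proof (intro conjI allI)
    show "q \<in> module_hom R NM M"
      using qG.f_hom NG unfolding NM_def module_hom_def by (auto simp: Pi_iff subset_iff)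
    show "q ` carrier NM = carrier M" "q ` piece NM d = piece M d" for d
      using gsG by (simp_all add: NM_def qN qNd graded_surj_def)
  qed (use modN qG.N.module_axioms in auto)
  interpret q: mod_hom R NM M q by (rule graded_surj_mod_hom[OF gs])
  have q0N: "q f = \<zero>\<^bsub>M\<^esub> \<longleftrightarrow> f \<in> I \<inter> N" if "f \<in> N" for f
    using q0[of f] that NG by auto
  have surj: "q ` carrier NM = carrier M" using gs by (simp add: graded_surj_def)
  have NM [simp]: "carrier NM = N" "zero NM = 0" "piece NM d = N \<inter> homogeneous n d" for d
    by (simp_all add: NM_def)

  have iso: "graded_isomorphic R M (quotient_module NM (I \<inter> N))"
  proof (rule graded_isomorphic_of_equal_kernels[OF gs graded_surj_quotient[OF modN subK]])
    show "q x = \<zero>\<^bsub>M\<^esub> \<longleftrightarrow> (I \<inter> N) +>\<^bsub>NM\<^esub> x = \<zero>\<^bsub>quotient_module NM (I \<inter> N)\<^esub>"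
      if "x \<in> carrier NM" for x
      using q0N that coset_eq_self_iff[OF modN subK] by (simp add: quotient_module_def)
  qed simp

  have vsN: "vs_pieces NM"
    unfolding NM_def by (rule vs_pieces_ideal_module[OF idN[unfolded R_def]])
  have fdN: "vectorspace.fin_dim class_ring (piece_space NM d)" for d
    unfolding NM_def N by (rule fin_dim_piece_supp_ideal[OF up(2)])
  have linC: "set \<Theta> \<subseteq> carrier R" if "set \<Theta> \<subseteq> homogeneous n 1" for \<Theta> :: "'k mpoly list"
    using that by (auto simp: homogeneous_def R_def)

  \<comment> \<open>Both pieces are images of the degree-k part of N, so their dimensions are
    compared through the kernels: \<Theta>N against the preimage of \<Theta>M, which is the image of
    \<Theta>N under \<open>q\<close>.\<close>
  have dims: "piece_dim (quotient_module M (seq_mult R \<Theta> M)) k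
        \<le> piece_dim (quotient_module NM (seq_mult R \<Theta> NM)) k"
      "piece_dim (quotient_module M (seq_mult R \<Theta> M)) k
        = piece_dim (quotient_module NM (seq_mult R \<Theta> NM)) k
        \<longleftrightarrow> (\<forall>x\<in>N \<inter> homogeneous n k. q x \<in> q ` lincombs \<Theta> N \<longrightarrow> x \<in> lincombs \<Theta> N)"
    if lin: "set \<Theta> \<subseteq> homogeneous n 1" for \<Theta> k
  proof -
    note \<Theta> = linC[OF lin]
    note subT = submodule_seq_mult[OF modM \<Theta>] and subS = submodule_seq_mult[OF modN \<Theta>]
    note g2 = graded_surj_comp[OF gs graded_surj_quotient[OF modM subT]]
    note g1 = graded_surj_quotient[OF modN subS]
    have S: "seq_mult R \<Theta> NM = lincombs \<Theta> N"
      unfolding NM_def R_def by (rule seq_mult_ideal_module[OF idN[unfolded R_def] \<Theta>[unfolded R_def]])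
    have T: "seq_mult R \<Theta> M = q ` lincombs \<Theta> N"
      unfolding S[symmetric] by (rule seq_mult_image[OF q.mod_hom_axioms surj \<Theta>])
    have k1: "seq_mult R \<Theta> NM +>\<^bsub>NM\<^esub> x = \<zero>\<^bsub>quotient_module NM (seq_mult R \<Theta> NM)\<^esub>
        \<longleftrightarrow> x \<in> lincombs \<Theta> N" if "x \<in> N" for x
      using coset_eq_self_iff[OF modN subS, of x] that S by (simp add: quotient_module_def)
    have k2: "seq_mult R \<Theta> M +>\<^bsub>M\<^esub> q x = \<zero>\<^bsub>quotient_module M (seq_mult R \<Theta> M)\<^esub>
        \<longleftrightarrow> q x \<in> q ` lincombs \<Theta> N" if "x \<in> N" for x
      using coset_eq_self_iff[OF modM subT, of "q x"] that T q.f_im[of x]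
      by (simp add: quotient_module_def)
    note * = piece_dim_le_of_kernels[OF g1[unfolded R_def] g2[unfolded R_def] vsN fdN, folded R_def]
    show "piece_dim (quotient_module M (seq_mult R \<Theta> M)) k
        \<le> piece_dim (quotient_module NM (seq_mult R \<Theta> NM)) k"
      by (rule *(1)) (simp add: k1 k2)
    have "piece_dim (quotient_module M (seq_mult R \<Theta> M)) k
        = piece_dim (quotient_module NM (seq_mult R \<Theta> NM)) k
        \<longleftrightarrow> (\<forall>x\<in>piece NM k. seq_mult R \<Theta> M +>\<^bsub>M\<^esub> q x = \<zero>\<^bsub>quotient_module M (seq_mult R \<Theta> M)\<^esub>
          \<longrightarrow> seq_mult R \<Theta> NM +>\<^bsub>NM\<^esub> x = \<zero>\<^bsub>quotient_module NM (seq_mult R \<Theta> NM)\<^esub>)"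
      by (rule *(2)) (simp add: k1 k2)
    then show "piece_dim (quotient_module M (seq_mult R \<Theta> M)) k
        = piece_dim (quotient_module NM (seq_mult R \<Theta> NM)) k
        \<longleftrightarrow> (\<forall>x\<in>N \<inter> homogeneous n k. q x \<in> q ` lincombs \<Theta> N \<longrightarrow> x \<in> lincombs \<Theta> N)"
      by (simp add: k1 k2)
  qed

  have "(piece_dim (quotient_module M (seq_mult R \<Theta> M)) k\<^sub>0
          = piece_dim (quotient_module NM (seq_mult R \<Theta> NM)) k\<^sub>0) \<longleftrightarrow> (\<forall>\<tau>\<in>AK. k\<^sub>0 < card \<tau>)"
    if "lsop n M \<Theta>" and ss: "seq_surjection R \<Theta> NM M q" for \<Theta> k\<^sub>0
  proof -
    have lin: "set \<Theta> \<subseteq> homogeneous n 1" and len: "ereal (real (length \<Theta>)) = module_dim R M"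
      using that(1) by (auto simp: lsop_def R_def)
    note \<Theta> = linC[OF lin]
    show ?thesis
      unfolding dims(2)[OF lin]
    proof
      assume P: "\<forall>\<tau>\<in>AK. k\<^sub>0 < card \<tau>"
      show "\<forall>x\<in>N \<inter> homogeneous n k\<^sub>0. q x \<in> q ` lincombs \<Theta> N \<longrightarrow> x \<in> lincombs \<Theta> N"
      proof (intro ballI impI)
        fix x assume x: "x \<in> N \<inter> homogeneous n k\<^sub>0" and "q x \<in> q ` lincombs \<Theta> N"
        then obtain y where y: "y \<in> lincombs \<Theta> N" "q x = q y" by auto
        have yN: "y \<in> N" using y(1) lincombs_subset[OF idN[unfolded R_def] \<Theta>[unfolded R_def]] by auto
        define \<kappa> where "\<kappa> = x - y"
        have "\<kappa> \<in> N" using x yN ideal_poly_diff[OF idN[unfolded R_def]] by (simp add: \<kappa>_def)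
        moreover have "q \<kappa> \<oplus>\<^bsub>M\<^esub> q y = q y"
          using q.f_add[of \<kappa> y] \<open>\<kappa> \<in> N\<close> yN y(2) by (simp add: NM_def \<kappa>_def)
        then have "q \<kappa> = \<zero>\<^bsub>M\<^esub>"
          using q.f_im[of \<kappa>] q.f_im[of y] \<open>\<kappa> \<in> N\<close> yN by (simp add: qG.N.M.add.r_cancel_one)
        ultimately have \<kappa>: "\<kappa> \<in> supp_ideal AK" using q0N K by auto
        \<comment> \<open>\<open>x\<close> is homogeneous but \<open>y\<close> need not be. In
          degree \<open>k\<^sub>0\<close> the difference \<kappa> disappears because K vanishes
          there, so \<open>x\<close> is a component of \<open>y\<close> and stays in
          \<Theta>N.\<close>
        then have "hcomp k\<^sub>0 \<kappa> \<in> supp_ideal AK \<inter> homogeneous n k\<^sub>0"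
          using supp_ideal_subset_carrier[OF upK] by (auto intro: hcomp_supp_ideal hcomp_in_homogeneous)
        then have "hcomp k\<^sub>0 \<kappa> = 0"
          using supp_ideal_low_degree_iff[OF upK, of k\<^sub>0, where ?'k = 'k] P by blast
        moreover have "hcomp k\<^sub>0 x = x" using hcomp_homogeneous[of x n k\<^sub>0 k\<^sub>0] x by simp
        moreover have "hcomp k\<^sub>0 x = hcomp k\<^sub>0 \<kappa> + hcomp k\<^sub>0 y"
          by (simp add: \<kappa>_def flip: hcomp_add)
        ultimately have xy: "x = hcomp k\<^sub>0 y" by simp
        show "x \<in> lincombs \<Theta> N"
        proof (cases k\<^sub>0)
          case 0
          then have "x = 0" using hcomp_lincombs(1)[OF lin up(2)] y(1) xy by (simp add: N)
          moreover have "0 \<in> lincombs \<Theta> N"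
            using ideal_poly_zero[OF idN[unfolded R_def]]
            unfolding lincombs_def by (intro CollectI exI[of _ "\<lambda>_. 0"]) simp
          ultimately show ?thesis by simp
        next
          case (Suc d)
          then have "x \<in> lincombs \<Theta> (supp_ideal AN \<inter> homogeneous n d)"
            using hcomp_lincombs(2)[OF lin up(2)] y(1) xy by (simp add: N)
          then show ?thesis using lincombs_mono[OF Int_lower1] by (auto simp: N)
        qed
      qed
    next
      assume L: "\<forall>x\<in>N \<inter> homogeneous n k\<^sub>0. q x \<in> q ` lincombs \<Theta> N \<longrightarrow> x \<in> lincombs \<Theta> N"
      show "\<forall>\<tau>\<in>AK. k\<^sub>0 < card \<tau>"
      proof
        fix \<tau> assume \<tau>: "\<tau> \<in> AK"
        have "ideal (annihilator R M) R" by (rule ideal_annihilator[OF modM])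
        \<comment> \<open>Any element of I multiplies N into K, which \<open>q\<close>
          kills.\<close>
        moreover have "sqfree_monomial \<tau> \<in> annihilator R M"
        proof -
          have sI: "sqfree_monomial \<tau> \<in> I"
            unfolding I by (rule sqfree_monomial_props(1)[OF _ up(1)]) (use \<tau> in \<open>simp add: AK_def\<close>)
          have sR: "sqfree_monomial \<tau> \<in> carrier R"
            using ideal_poly_carrier[OF idI[unfolded R_def]] sI by (auto simp: R_def)
          have "sqfree_monomial \<tau> \<odot>\<^bsub>M\<^esub> X = \<zero>\<^bsub>M\<^esub>" if X: "X \<in> carrier M" for X
          proof -
            obtain x where x: "x \<in> N" "X = q x" using X surj by auto
            then have "sqfree_monomial \<tau> \<odot>\<^bsub>M\<^esub> X = q (sqfree_monomial \<tau> * x)"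
              using q.f_smult[OF sR, of x] by (simp add: NM_def)
            moreover have "sqfree_monomial \<tau> * x \<in> I \<inter> N"
              using ideal_poly_mult[OF idN[unfolded R_def] sR[unfolded R_def] x(1)]
                ideal_poly_mult[OF idI[unfolded R_def] _ sI, of x]
                ideal_poly_carrier[OF idN[unfolded R_def]] x(1) by (auto simp: mult.commute)
            ultimately show ?thesis using q0N by auto
          qed
          then show ?thesis using sR by (simp add: annihilator_def)
        qed
        ultimately have "module_dim R M < ereal (real n)"
          unfolding module_dim_def R_def
          by (rule krull_dim_quot_less) (rule sqfree_monomial_props(3)[OF \<tau> upK])
        then have "length \<Theta> < n" unfolding len[symmetric] by simp
        moreover have "supp_ideal AK \<inter> homogeneous n k\<^sub>0 \<subseteq> lincombs \<Theta> (supp_ideal AK)"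
        proof
          fix x :: "'k mpoly" assume x: "x \<in> supp_ideal AK \<inter> homogeneous n k\<^sub>0"
          then have xK: "x \<in> I \<inter> N" by (simp add: K)
          \<comment> \<open>An element of K has the same image as 0, so \<open>L\<close> places it
            in \<Theta>N; \<open>seq_surjection_kernel\<close> for the full sequence then moves it
            into \<Theta>K.\<close>
          have "0 \<in> lincombs \<Theta> N"
            using ideal_poly_zero[OF idN[unfolded R_def]]
            unfolding lincombs_def by (intro CollectI exI[of _ "\<lambda>_. 0"]) simp
          moreover have "q x = q 0"
            using q0N[of x] q0N[of 0] xK ideal_poly_zero[OF idN[unfolded R_def]]
              ideal_poly_zero[OF idI[unfolded R_def]] by simp
          ultimately have "x \<in> lincombs \<Theta> N" using L x xK by blast
          then have "x \<in> lincombs (take (length \<Theta>) \<Theta>) (I \<inter> N)"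
            using seq_surjection_kernel[OF ss[unfolded R_def NM_def] idN[unfolded R_def]
                modM[unfolded R_def] \<Theta>[unfolded R_def] q0N, of "length \<Theta>" x] xK
            by simp
          then show "x \<in> lincombs \<Theta> (supp_ideal AK)" by (simp add: K)
        qed
        ultimately show "k\<^sub>0 < card \<tau>"
          using no_generators_up_to_degree[OF upK lin] \<tau> by blast
      qed
    qed
  qed
  moreover have "(\<forall>k\<le>k\<^sub>0. pieces_isomorphic M NM k) \<longleftrightarrow> (\<forall>\<tau>\<in>AK. k\<^sub>0 < card \<tau>)" for k\<^sub>0
  proof -
    have "pieces_isomorphic M NM k \<longleftrightarrow> supp_ideal AK \<inter> homogeneous n k \<subseteq> {0 :: 'k mpoly}" for k
      unfolding pieces_isomorphic_iff_kernel[OF gs[unfolded R_def] vsN fdN] K[symmetric]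
      using q0N by auto
    then show ?thesis by (simp only: supp_ideal_low_degree_iff[OF upK, of k\<^sub>0, where ?'k = 'k])
  qed
  moreover have "generated_in_degrees_above n k\<^sub>0 (I \<inter> N) \<longleftrightarrow> (\<forall>\<tau>\<in>AK. k\<^sub>0 < card \<tau>)" for k\<^sub>0
    unfolding K by (rule generated_in_degrees_above_supp_ideal[OF upK])
  moreover have "(\<forall>\<tau>. \<tau> \<subseteq> {1..n} \<and> \<tau> \<notin> \<Delta> \<and> int (card \<tau>) - 1 < int k\<^sub>0 \<longrightarrow>
      (\<exists>\<Gamma>\<in>\<G>. \<tau> \<subseteq> vertex_set \<Gamma>)) \<longleftrightarrow> (\<forall>\<tau>\<in>AK. k\<^sub>0 < card \<tau>)" for k\<^sub>0
  proof -
    \<comment> \<open>The dimension of \<tau> is one less than its size, so dimension below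
      \<open>k\<^sub>0\<close> means at most \<open>k\<^sub>0\<close> vertices; integers give the
      empty set dimension -1.\<close>
    have "int (card \<tau>) - 1 < int k\<^sub>0 \<longleftrightarrow> \<not> k\<^sub>0 < card \<tau>" for \<tau> :: "nat set" by linarith
    then show ?thesis unfolding AK_def AI_def AN_def by blast
  qed
  ultimately show ?thesis
    using iso dims(1) unfolding Let_def by simp
qed

end
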